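(* Let $G$ be a Lie group over $\mathbb{K}$ with Lie algebra $\mathfrak{g}=T_eG$. The group commutator $[g,h]=ghg^{-1}h^{-1}$ in $(TTG)_e$ of an element $g=\varepsilon_1v$ from the first axis and an element $h=\varepsilon_2w$ from the second axis, where $v,w\in\mathfrak{g}$, is expressed by the Lie bracket $[v,w]$ of $\mathfrak{g}$ as $$[\varepsilon_1v,\varepsilon_2w]=\varepsilon_1\varepsilon_2[v,w],$$ and the third axis $\varepsilon_1\varepsilon_2\mathfrak{g}$ is central in $(TTG)_e$, i.e. for $j=1,2$ and all $u,v\in\mathfrak{g}$, $$[\varepsilon_1\varepsilon_2u,\varepsilon_jv]=0,$$ where $0$ denotes the neutral element of $(TTG)_e$.
   Context: $\mathbb{K}$ is a commutative unital Hausdorff topological ring with open dense unit group and continuous inversion; topological modules are Hausdorff. A map $f:V\supset U\to W$ ($U$ open, $V,W$ topological $\mathbb{K}$-modules) is $C^1$ if there is a continuous $f^{[1]}$ on $\{(x,v,t)\in U\times V\times\mathbb{K}:x+tv\in U\}$ with $f(x+tv)-f(x)=tf^{[1]}(x,v,t)$; $df(x)v=f^{[1]}(x,v,0)$; $C^{j+1}$ means $C^1$ with $f^{[1]}$ of class $C^j$; smooth means $C^j$ for all $j$. Manifolds and tangent bundles are defined by charts; $Tf(x,v)=(f(x),df(x)v)$ in charts. A Lie group over $\mathbb{K}$ is a smooth manifold with smooth group multiplication $m$ and inversion. The Lie algebra: vector fields carry the bracket given in charts by $[X,Y](x)=dX(x)Y(x)-dY(x)X(x)$; for $v\in\mathfrak{g}=T_eG$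 let $v^R$ be the right-invariant vector field with $v^R(e)=v$; then $[v,w]:=[v^R,w^R](e)$. $TTG=T(TG)$ is a Lie group with multiplication $TTm$, and the fiber $(TTG)_e$ over $e\in G$ is a normal subgroup. In a chart around $e$ (with $e$ corresponding to $0\in V$) elements of $(TTG)_e$ are written $\varepsilon_1v_1+\varepsilon_2v_2+\varepsilon_1\varepsilon_2v_{12}$ with $v_1,v_2,v_{12}\in V\cong\mathfrak{g}$; for $v\in\mathfrak{g}$ the elements $\varepsilon_1v$, $\varepsilon_2v$, $\varepsilon_1\varepsilon_2v$ of the three axes are those with only one nonzero component $v$ (this is independent of the chart). *)

theory Defs
  imports "HOL-Analysis.Analysis" "HOL-Algebra.Group"
begin

section \<open>Base ring and topological modules\<close>

class smooth_base_ring = comm_ring_1 + t2_space + topological_ab_group_add + topological_semigroup_mult +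
  assumes open_units: "open {x. x dvd 1}"
    and dense_units: "open U \<Longrightarrow> U \<noteq> {} \<Longrightarrow> \<exists>x\<in>U. x dvd 1"
    and continuous_unit_inverse: "x dvd 1 \<Longrightarrow>
      filterlim (\<lambda>x. THE y. x * y = 1) (nhds (THE y. x * y = 1)) (at x within {x. x dvd 1})"

text \<open>Hausdorffness and continuity of the addition of a topological module come from the sort
  of its type.\<close>

locale topological_module = module scale
  for scale :: "'k::smooth_base_ring \<Rightarrow> 'v::{topological_ab_group_add,t2_space} \<Rightarrow> 'v" +
  assumes continuous_scale: "continuous_on UNIV (\<lambda>(a, x). scale a x)"

instance prod :: (topological_monoid_add, topological_monoid_add) topological_monoid_add
proof
  fix a b :: "'a \<times> 'b"
  have *: "((\<lambda>x::('a \<times> 'b) \<times> 'a \<times> 'b. x) \<longlongrightarrow> (a, b)) (nhds a \<times>\<^sub>F nhds b)"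
    by (simp add: filterlim_ident nhds_prod)
  show "LIM x (nhds a \<times>\<^sub>F nhds b). fst x + snd x :> nhds (a + b)"
    unfolding plus_prod_def using tendsto_fst[OF *] tendsto_snd[OF *]
    by (intro tendsto_Pair tendsto_add tendsto_fst tendsto_snd) simp_all
qed

instance prod :: (topological_group_add, topological_group_add) topological_group_add
proof
  fix a :: "'a \<times> 'b"
  show "(uminus \<longlongrightarrow> - a) (nhds a)"
    unfolding uminus_prod_def
    by (intro tendsto_Pair tendsto_minus tendsto_fst tendsto_snd filterlim_ident)
qed

instance prod :: (topological_ab_group_add, topological_ab_group_add) topological_ab_group_add ..

definition prod_scale :: "('k \<Rightarrow> 'v \<Rightarrow> 'v) \<Rightarrow> ('k \<Rightarrow> 'w \<Rightarrow> 'w) \<Rightarrow> 'k \<Rightarrow> 'v \<times> 'w \<Rightarrow> 'v \<times> 'w" where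
  "prod_scale s s' a = map_prod (s a) (s' a)"

section \<open>Differential calculus\<close>

text \<open>The domain \<open>U\<^sup>[\<^sup>1\<^sup>]\<close> of \<open>f\<^sup>[\<^sup>1\<^sup>]\<close>, and the statement that \<open>g\<close> is a continuous \<open>f\<^sup>[\<^sup>1\<^sup>]\<close>.
  The topology and the operations of the source module are explicit arguments, because below
  the source is a set of trees and not a whole type.\<close>

definition ext_dom ::
  "'a topology \<Rightarrow> ('a \<Rightarrow> 'a \<Rightarrow> 'a) \<Rightarrow> ('k \<Rightarrow> 'a \<Rightarrow> 'a) \<Rightarrow> 'a set \<Rightarrow> ('a \<times> 'a \<times> 'k) set" where
  "ext_dom T add s U = {(x, v, t). x \<in> U \<and> v \<in> topspace T \<and> add x (s t v) \<in> U}"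

definition is_ext ::
  "'a topology \<Rightarrow> ('a \<Rightarrow> 'a \<Rightarrow> 'a) \<Rightarrow> ('k::smooth_base_ring \<Rightarrow> 'a \<Rightarrow> 'a) \<Rightarrow>
   ('k \<Rightarrow> 'w::{topological_ab_group_add,t2_space} \<Rightarrow> 'w) \<Rightarrow>
   'a set \<Rightarrow> ('a \<Rightarrow> 'w) \<Rightarrow> ('a \<times> 'a \<times> 'k \<Rightarrow> 'w) \<Rightarrow> bool" where
  "is_ext T add s s' U f g \<longleftrightarrow>
     continuous_map
       (subtopology (prod_topology T (prod_topology T euclidean)) (ext_dom T add s U)) euclidean g \<and>
     (\<forall>(x, v, t) \<in> ext_dom T add s U. f (add x (s t v)) - f x = s' t (g (x, v, t)))"

text \<open>The recursion ``\<open>f\<close> is \<open>C\<^bsup>j+1\<^esup>\<close> iff \<open>f\<close> is \<open>C\<^sup>1\<close> and \<open>f\<^sup>[\<^sup>1\<^sup>]\<close> is \<open>C\<^bsup>j\<^esup>\<close>'' replaces the source module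
  \<open>V\<close> by \<open>V \<times> V \<times> K\<close>, which has another type. The modules \<open>V\<^sup>[\<^sup>0\<^sup>] = V\<close> and
  \<open>V\<^bsup>[n+1]\<^esup> = V\<^bsup>[n]\<^esup> \<times> V\<^bsup>[n]\<^esup> \<times> K\<close> are therefore collected in one datatype: \<open>Step x v t\<close> stands for the
  triple \<open>(x, v, t)\<close>, and \<open>V\<^bsup>[n]\<^esup>\<close> is the set of complete trees of depth \<open>n\<close>.\<close>

datatype ('k, 'v) tree = Pt (pt: 'v) | Step (base: "('k, 'v) tree") (dir: "('k, 'v) tree") (par: 'k)

primrec tree_top :: "nat \<Rightarrow> ('k::topological_space, 'v::topological_space) tree topology" where
  "tree_top 0 = pullback_topology (range Pt) pt euclidean"
| "tree_top (Suc n) =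
     pullback_topology
       ((\<lambda>(x, v, t). Step x v t) ` (topspace (tree_top n) \<times> topspace (tree_top n) \<times> UNIV))
       (\<lambda>z. (base z, dir z, par z))
       (prod_topology (tree_top n) (prod_topology (tree_top n) euclidean))"

fun tree_plus :: "('k::plus, 'v::plus) tree \<Rightarrow> ('k, 'v) tree \<Rightarrow> ('k, 'v) tree" where
  "tree_plus (Pt x) (Pt y) = Pt (x + y)"
| "tree_plus (Step x v t) (Step x' v' t') = Step (tree_plus x x') (tree_plus v v') (t + t')"
| "tree_plus _ _ = undefined"

primrec tree_scale :: "('k::times \<Rightarrow> 'v \<Rightarrow> 'v) \<Rightarrow> 'k \<Rightarrow> ('k, 'v) tree \<Rightarrow> ('k, 'v) tree" where
  "tree_scale s a (Pt x) = Pt (s a x)"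
| "tree_scale s a (Step x v t) = Step (tree_scale s a x) (tree_scale s a v) (a * t)"

text \<open>\<open>Cj_tree s s' j n U f\<close>: the map \<open>f\<close> on the subset \<open>U\<close> of \<open>V\<^bsup>[n]\<^esup>\<close> is of class \<open>C\<^bsup>j\<^esup>\<close>.\<close>

primrec Cj_tree ::
  "('k::smooth_base_ring \<Rightarrow> 'v::{topological_ab_group_add,t2_space} \<Rightarrow> 'v) \<Rightarrow>
   ('k \<Rightarrow> 'w::{topological_ab_group_add,t2_space} \<Rightarrow> 'w) \<Rightarrow>
   nat \<Rightarrow> nat \<Rightarrow> ('k, 'v) tree set \<Rightarrow> (('k, 'v) tree \<Rightarrow> 'w) \<Rightarrow> bool" where
  "Cj_tree s s' 0 n U f \<longleftrightarrow> continuous_map (subtopology (tree_top n) U) euclidean f"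
| "Cj_tree s s' (Suc j) n U f \<longleftrightarrow>
     (\<exists>g. is_ext (tree_top n) tree_plus (tree_scale s) s' U f g \<and>
       Cj_tree s s' j (Suc n)
         ((\<lambda>(x, v, t). Step x v t) ` ext_dom (tree_top n) tree_plus (tree_scale s) U)
         (\<lambda>z. g (base z, dir z, par z)))"

definition Cj_on ::
  "('k::smooth_base_ring \<Rightarrow> 'v::{topological_ab_group_add,t2_space} \<Rightarrow> 'v) \<Rightarrow>
   ('k \<Rightarrow> 'w::{topological_ab_group_add,t2_space} \<Rightarrow> 'w) \<Rightarrow> nat \<Rightarrow> 'v set \<Rightarrow> ('v \<Rightarrow> 'w) \<Rightarrow> bool" where
  "Cj_on s s' j U f \<longleftrightarrow> open U \<and> Cj_tree s s' j 0 (Pt ` U) (f \<circ> pt)"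

definition smooth_on ::
  "('k::smooth_base_ring \<Rightarrow> 'v::{topological_ab_group_add,t2_space} \<Rightarrow> 'v) \<Rightarrow>
   ('k \<Rightarrow> 'w::{topological_ab_group_add,t2_space} \<Rightarrow> 'w) \<Rightarrow> 'v set \<Rightarrow> ('v \<Rightarrow> 'w) \<Rightarrow> bool" where
  "smooth_on s s' U f \<longleftrightarrow> (\<forall>j. Cj_on s s' j U f)"

text \<open>\<open>df(x)v = f\<^sup>[\<^sup>1\<^sup>](x,v,0)\<close>; the value does not depend on the choice of \<open>f\<^sup>[\<^sup>1\<^sup>]\<close> because the units are
  dense and \<open>W\<close> is Hausdorff.\<close>

definition differential ::
  "('k::smooth_base_ring \<Rightarrow> 'v::{topological_ab_group_add,t2_space} \<Rightarrow> 'v) \<Rightarrow>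
   ('k \<Rightarrow> 'w::{topological_ab_group_add,t2_space} \<Rightarrow> 'w) \<Rightarrow> 'v set \<Rightarrow> ('v \<Rightarrow> 'w) \<Rightarrow> 'v \<Rightarrow> 'v \<Rightarrow> 'w" where
  "differential s s' U f x v = (THE w. \<exists>g. is_ext euclidean (+) s s' U f g \<and> w = g (x, v, 0))"

section \<open>Manifolds\<close>

text \<open>A manifold is given by its atlas. A chart is a domain together with a map, of which only the
  values on the domain matter. The topology of the manifold is the one induced by the charts.\<close>

type_synonym ('m, 'v) chart = "'m set \<times> ('m \<Rightarrow> 'v)"

type_synonym ('m, 'v) atlas = "('m, 'v) chart set"

definition chart_inv :: "('m, 'v) chart \<Rightarrow> 'v \<Rightarrow> 'm" where
  "chart_inv c = inv_into (fst c) (snd c)"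

definition rep_dom :: "('m, 'v) chart \<Rightarrow> ('n, 'w) chart \<Rightarrow> ('m \<Rightarrow> 'n) \<Rightarrow> 'v set" where
  "rep_dom c d f = snd c ` (fst c \<inter> f -` fst d)"

definition rep :: "('m, 'v) chart \<Rightarrow> ('n, 'w) chart \<Rightarrow> ('m \<Rightarrow> 'n) \<Rightarrow> 'v \<Rightarrow> 'w" where
  "rep c d f = snd d \<circ> f \<circ> chart_inv c"

definition points :: "('m, 'v) atlas \<Rightarrow> 'm set" where
  "points A = (\<Union>c\<in>A. fst c)"

text \<open>With \<open>f = id\<close>, \<^const>\<open>rep\<close> is the change of charts. Recall that \<^const>\<open>smooth_on\<close> requires the
  domain to be open.\<close>

definition manifold ::
  "('k::smooth_base_ring \<Rightarrow> 'v::{topological_ab_group_add,t2_space} \<Rightarrow> 'v) \<Rightarrow> ('m, 'v) atlas \<Rightarrow> bool" where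
  "manifold s A \<longleftrightarrow>
     (\<forall>c\<in>A. inj_on (snd c) (fst c) \<and> open (snd c ` fst c)) \<and>
     (\<forall>c\<in>A. \<forall>d\<in>A. smooth_on s s (rep_dom c d id) (rep c d id))"

definition smooth_map ::
  "('k::smooth_base_ring \<Rightarrow> 'v::{topological_ab_group_add,t2_space} \<Rightarrow> 'v) \<Rightarrow> ('m, 'v) atlas \<Rightarrow>
   ('k \<Rightarrow> 'w::{topological_ab_group_add,t2_space} \<Rightarrow> 'w) \<Rightarrow> ('n, 'w) atlas \<Rightarrow> ('m \<Rightarrow> 'n) \<Rightarrow> bool" where
  "smooth_map s A s' B f \<longleftrightarrow>
     f ` points A \<subseteq> points B \<and>
     (\<forall>c\<in>A. \<forall>d\<in>B. smooth_on s s' (rep_dom c d f) (rep c d f))"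

definition prod_chart :: "('m, 'v) chart \<Rightarrow> ('n, 'w) chart \<Rightarrow> ('m \<times> 'n, 'v \<times> 'w) chart" where
  "prod_chart c d = (fst c \<times> fst d, map_prod (snd c) (snd d))"

definition prod_atlas :: "('m, 'v) atlas \<Rightarrow> ('n, 'w) atlas \<Rightarrow> ('m \<times> 'n, 'v \<times> 'w) atlas" where
  "prod_atlas A B = {prod_chart c d |c d. c \<in> A \<and> d \<in> B}"

section \<open>Tangent bundles\<close>

text \<open>A tangent vector at \<open>p\<close> is the pair of \<open>p\<close> and the set of all \<open>(c, v)\<close> where \<open>v\<close> is the
  component of the tangent vector in the chart \<open>c\<close> around \<open>p\<close>.\<close>

type_synonym ('m, 'v) tvec = "'m \<times> (('m, 'v) chart \<times> 'v) set"

definition tangent_vector ::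
  "('k::smooth_base_ring \<Rightarrow> 'v::{topological_ab_group_add,t2_space} \<Rightarrow> 'v) \<Rightarrow> ('m, 'v) atlas \<Rightarrow>
   ('m, 'v) chart \<Rightarrow> 'm \<Rightarrow> 'v \<Rightarrow> ('m, 'v) tvec" where
  "tangent_vector s A c p v =
     (p, {(d, differential s s (rep_dom c d id) (rep c d id) (snd c p) v) |d. d \<in> A \<and> p \<in> fst d})"

definition component :: "('m, 'v) chart \<Rightarrow> ('m, 'v) tvec \<Rightarrow> 'v" where
  "component c \<xi> = (THE v. (c, v) \<in> snd \<xi>)"

definition zero_vector :: "('m, 'v::zero) atlas \<Rightarrow> 'm \<Rightarrow> ('m, 'v) tvec" where
  "zero_vector A p = (p, {(d, 0) |d. d \<in> A \<and> p \<in> fst d})"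

definition tangent_chart ::
  "('k::smooth_base_ring \<Rightarrow> 'v::{topological_ab_group_add,t2_space} \<Rightarrow> 'v) \<Rightarrow> ('m, 'v) atlas \<Rightarrow>
   ('m, 'v) chart \<Rightarrow> (('m, 'v) tvec, 'v \<times> 'v) chart" where
  "tangent_chart s A c =
     ({tangent_vector s A c p v |p v. p \<in> fst c}, \<lambda>\<xi>. (snd c (fst \<xi>), component c \<xi>))"

definition tangent_bundle ::
  "('k::smooth_base_ring \<Rightarrow> 'v::{topological_ab_group_add,t2_space} \<Rightarrow> 'v) \<Rightarrow> ('m, 'v) atlas \<Rightarrow>
   (('m, 'v) tvec, 'v \<times> 'v) atlas" where
  "tangent_bundle s A = tangent_chart s A ` A"

definition tangent_space ::
  "('k::smooth_base_ring \<Rightarrow> 'v::{topological_ab_group_add,t2_space} \<Rightarrow> 'v) \<Rightarrow> ('m, 'v) atlas \<Rightarrow>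
   'm \<Rightarrow> ('m, 'v) tvec set" where
  "tangent_space s A p = {\<xi> \<in> points (tangent_bundle s A). fst \<xi> = p}"

definition tangent_map ::
  "('k::smooth_base_ring \<Rightarrow> 'v::{topological_ab_group_add,t2_space} \<Rightarrow> 'v) \<Rightarrow>
   ('k \<Rightarrow> 'w::{topological_ab_group_add,t2_space} \<Rightarrow> 'w) \<Rightarrow> ('n, 'w) atlas \<Rightarrow>
   ('m \<Rightarrow> 'n) \<Rightarrow> ('m, 'v) tvec \<Rightarrow> ('n, 'w) tvec" where
  "tangent_map s s' B f \<xi> =
     (f (fst \<xi>),
      {(d, differential s s' (rep_dom c d f) (rep c d f) (snd c (fst \<xi>)) v) |c v d.
         (c, v) \<in> snd \<xi> \<and> d \<in> B \<and> f (fst \<xi>) \<in> fst d})"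

text \<open>The canonical identification of \<open>TM \<times> TN\<close> with \<open>T(M \<times> N)\<close>.\<close>

definition tangent_pair :: "('m, 'v) tvec \<Rightarrow> ('n, 'w) tvec \<Rightarrow> ('m \<times> 'n, 'v \<times> 'w) tvec" where
  "tangent_pair \<xi> \<eta> =
     ((fst \<xi>, fst \<eta>),
      {(prod_chart c d, (v, w)) |c v d w. (c, v) \<in> snd \<xi> \<and> (d, w) \<in> snd \<eta>})"

section \<open>Vector fields\<close>

definition principal_part :: "('m, 'v) chart \<Rightarrow> ('m \<Rightarrow> ('m, 'v) tvec) \<Rightarrow> 'v \<Rightarrow> 'v" where
  "principal_part c X x = component c (X (chart_inv c x))"

text \<open>The vector field with principal part \<open>dX(x)Y(x) - dY(x)X(x)\<close> in every chart. This sign is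
  opposite to the convention common in real differential geometry.\<close>

definition field_bracket ::
  "('k::smooth_base_ring \<Rightarrow> 'v::{topological_ab_group_add,t2_space} \<Rightarrow> 'v) \<Rightarrow> ('m, 'v) atlas \<Rightarrow>
   ('m \<Rightarrow> ('m, 'v) tvec) \<Rightarrow> ('m \<Rightarrow> ('m, 'v) tvec) \<Rightarrow> 'm \<Rightarrow> ('m, 'v) tvec" where
  "field_bracket s A X Y p =
     (p, {(c, differential s s (snd c ` fst c) (principal_part c X) (snd c p) (component c (Y p))
            - differential s s (snd c ` fst c) (principal_part c Y) (snd c p) (component c (X p))) |c.
          c \<in> A \<and> p \<in> fst c})"

section \<open>Lie groups\<close>

locale lie_group = topological_module scale + group G
  for scale :: "'k::smooth_base_ring \<Rightarrow> 'v::{topological_ab_group_add,t2_space} \<Rightarrow> 'v"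
    and A :: "('g, 'v) atlas"
    and G :: "('g, 'b) monoid_scheme" (structure) +
  assumes manifold: "manifold scale A"
    and carrier_eq: "carrier G = points A"
    and smooth_mult:
      "smooth_map (prod_scale scale scale) (prod_atlas A A) scale A (\<lambda>(x, y). x \<otimes> y)"
    and smooth_inv: "smooth_map scale A scale A (\<lambda>x. inv x)"

definition right_invariant_field ::
  "('k::smooth_base_ring \<Rightarrow> 'v::{topological_ab_group_add,t2_space} \<Rightarrow> 'v) \<Rightarrow> ('g, 'v) atlas \<Rightarrow>
   ('g, 'b) monoid_scheme \<Rightarrow> ('g, 'v) tvec \<Rightarrow> 'g \<Rightarrow> ('g, 'v) tvec" where
  "right_invariant_field s A G v g = tangent_map s s A (\<lambda>x. x \<otimes>\<^bsub>G\<^esub> g) v"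

definition lie_bracket ::
  "('k::smooth_base_ring \<Rightarrow> 'v::{topological_ab_group_add,t2_space} \<Rightarrow> 'v) \<Rightarrow> ('g, 'v) atlas \<Rightarrow>
   ('g, 'b) monoid_scheme \<Rightarrow> ('g, 'v) tvec \<Rightarrow> ('g, 'v) tvec \<Rightarrow> ('g, 'v) tvec" where
  "lie_bracket s A G v w =
     field_bracket s A (right_invariant_field s A G v) (right_invariant_field s A G w) \<one>\<^bsub>G\<^esub>"

text \<open>The tangent group: the multiplication is \<open>Tm\<close> after the identification of \<open>TG \<times> TG\<close> with
  \<open>T(G \<times> G)\<close>. The inverse is the inverse of this group.\<close>

definition tangent_group ::
  "('k::smooth_base_ring \<Rightarrow> 'v::{topological_ab_group_add,t2_space} \<Rightarrow> 'v) \<Rightarrow> ('g, 'v) atlas \<Rightarrow>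
   ('g, 'b) monoid_scheme \<Rightarrow> ('g, 'v) tvec monoid" where
  "tangent_group s A G =
     \<lparr>carrier = points (tangent_bundle s A),
      mult = (\<lambda>\<xi> \<eta>. tangent_map (prod_scale s s) s A (\<lambda>(x, y). x \<otimes>\<^bsub>G\<^esub> y) (tangent_pair \<xi> \<eta>)),
      one = zero_vector A \<one>\<^bsub>G\<^esub>\<rparr>"

definition TT_group ::
  "('k::smooth_base_ring \<Rightarrow> 'v::{topological_ab_group_add,t2_space} \<Rightarrow> 'v) \<Rightarrow> ('g, 'v) atlas \<Rightarrow>
   ('g, 'b) monoid_scheme \<Rightarrow> (('g, 'v) tvec, 'v \<times> 'v) tvec monoid" where
  "TT_group s A G = tangent_group (prod_scale s s) (tangent_bundle s A) (tangent_group s A G)"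

text \<open>The fiber of \<open>TTG\<close> over the neutral element, as a group.\<close>

definition TT_fiber ::
  "('k::smooth_base_ring \<Rightarrow> 'v::{topological_ab_group_add,t2_space} \<Rightarrow> 'v) \<Rightarrow> ('g, 'v) atlas \<Rightarrow>
   ('g, 'b) monoid_scheme \<Rightarrow> (('g, 'v) tvec, 'v \<times> 'v) tvec monoid" where
  "TT_fiber s A G =
     (TT_group s A G)\<lparr>carrier := {\<xi> \<in> carrier (TT_group s A G). fst (fst \<xi>) = \<one>\<^bsub>G\<^esub>}\<rparr>"

definition commutator :: "('a, 'b) monoid_scheme \<Rightarrow> 'a \<Rightarrow> 'a \<Rightarrow> 'a" where
  "commutator H g h = g \<otimes>\<^bsub>H\<^esub> h \<otimes>\<^bsub>H\<^esub> inv\<^bsub>H\<^esub> g \<otimes>\<^bsub>H\<^esub> inv\<^bsub>H\<^esub> h"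

text \<open>The element \<open>\<epsilon>\<^sub>1v\<^sub>1 + \<epsilon>\<^sub>2v\<^sub>2 + \<epsilon>\<^sub>1\<epsilon>\<^sub>2v\<^sub>1\<^sub>2\<close> of the fiber of \<open>TTM\<close> over \<open>p\<close> in the chart \<open>TTc\<close>. The
  coordinates of \<open>T(TM)\<close> are \<open>((x, v\<^sub>1), (v\<^sub>2, v\<^sub>1\<^sub>2))\<close>, where \<open>\<epsilon>\<^sub>1\<close> belongs to the inner and \<open>\<epsilon>\<^sub>2\<close> to the
  outer tangent functor. The chart \<open>c\<close> need not send \<open>p\<close> to \<open>0\<close>: subtracting \<open>c(p)\<close> from
  \<open>c\<close> changes only the coordinate \<open>x\<close>.\<close>

definition TT_element ::
  "('k::smooth_base_ring \<Rightarrow> 'v::{topological_ab_group_add,t2_space} \<Rightarrow> 'v) \<Rightarrow> ('m, 'v) atlas \<Rightarrow>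
   ('m, 'v) chart \<Rightarrow> 'm \<Rightarrow> 'v \<Rightarrow> 'v \<Rightarrow> 'v \<Rightarrow> (('m, 'v) tvec, 'v \<times> 'v) tvec" where
  "TT_element s A c p v\<^sub>1 v\<^sub>2 v\<^sub>1\<^sub>2 =
     chart_inv (tangent_chart (prod_scale s s) (tangent_bundle s A) (tangent_chart s A c))
       ((snd c p, v\<^sub>1), (v\<^sub>2, v\<^sub>1\<^sub>2))"

text \<open>The axis elements \<open>\<epsilon>\<^sub>1v\<close>, \<open>\<epsilon>\<^sub>2v\<close>, \<open>\<epsilon>\<^sub>1\<epsilon>\<^sub>2v\<close> for a tangent vector \<open>v\<close>, formed with the chart \<open>c\<close>.\<close>

definition eps1 ::
  "('k::smooth_base_ring \<Rightarrow> 'v::{topological_ab_group_add,t2_space} \<Rightarrow> 'v) \<Rightarrow> ('m, 'v) atlas \<Rightarrow>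
   ('m, 'v) chart \<Rightarrow> ('m, 'v) tvec \<Rightarrow> (('m, 'v) tvec, 'v \<times> 'v) tvec" where
  "eps1 s A c v = TT_element s A c (fst v) (component c v) 0 0"

definition eps2 ::
  "('k::smooth_base_ring \<Rightarrow> 'v::{topological_ab_group_add,t2_space} \<Rightarrow> 'v) \<Rightarrow> ('m, 'v) atlas \<Rightarrow>
   ('m, 'v) chart \<Rightarrow> ('m, 'v) tvec \<Rightarrow> (('m, 'v) tvec, 'v \<times> 'v) tvec" where
  "eps2 s A c v = TT_element s A c (fst v) 0 (component c v) 0"

definition eps12 ::
  "('k::smooth_base_ring \<Rightarrow> 'v::{topological_ab_group_add,t2_space} \<Rightarrow> 'v) \<Rightarrow> ('m, 'v) atlas \<Rightarrow>
   ('m, 'v) chart \<Rightarrow> ('m, 'v) tvec \<Rightarrow> (('m, 'v) tvec, 'v \<times> 'v) tvec" where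
  "eps12 s A c v = TT_element s A c (fst v) 0 0 (component c v)"

end

theory Submission
  imports Defs
begin

text \<open>
  Choose a chart \<open>c\<close> around the neutral element and let \<open>\<mu>\<close> be the multiplication in this chart. Since
  \<open>\<mu>(x, o) = x = \<mu>(o, x)\<close> for the origin \<open>o = c(\<one>)\<close>, the differential of \<open>\<mu>\<close> at \<open>(o, o)\<close> is the addition,
  and the second differential at \<open>(o, o)\<close> vanishes on two vectors of the same factor. By symmetry and
  additivity the whole second differential is thus determined by the mixed part
  \<open>B v w = d\<^sup>2\<mu>(o, o)((v, 0), (0, w))\<close>, called \<open>mixed\<close> below:
  \<open>d\<^sup>2\<mu>(o, o)((v, w), (v', w')) = B v w' + B v' w\<close>.

  The second tangent map of any map \<open>f\<close> sends \<open>((x, v\<^sub>1), (v\<^sub>2, v\<^sub>1\<^sub>2))\<close> to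
  \<open>((f x, df(x)v\<^sub>1), (df(x)v\<^sub>2, d\<^sup>2f(x)(v\<^sub>1, v\<^sub>2) + df(x)v\<^sub>1\<^sub>2))\<close>. For \<open>\<mu>\<close> this
  yields the product in the fiber of \<open>TTG\<close> over \<open>\<one>\<close> (\<open>mult_TT_fiber\<close>):
  \<open>(v\<^sub>1, v\<^sub>2, v\<^sub>1\<^sub>2)(w\<^sub>1, w\<^sub>2, w\<^sub>1\<^sub>2) = (v\<^sub>1 + w\<^sub>1, v\<^sub>2 + w\<^sub>2, v\<^sub>1\<^sub>2 + w\<^sub>1\<^sub>2 + B v\<^sub>1 w\<^sub>2 + B v\<^sub>2 w\<^sub>1)\<close>.
  Biadditivity of \<open>B\<close> alone shows that this is a group, that the third axis is central, and that
  \<open>\<epsilon>\<^sub>1v\<close> and \<open>\<epsilon>\<^sub>2w\<close> have the commutator \<open>\<epsilon>\<^sub>1\<epsilon>\<^sub>2(B v w - B w v)\<close>. On the other side, the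
  right-invariant field of \<open>v\<close> has the principal part \<open>x \<mapsto> d\<mu>(o, x)(v, 0)\<close>, whose differential at \<open>o\<close> in direction \<open>w\<close> is
  \<open>B v w\<close>; so \<open>B v w - B w v\<close> is also the Lie bracket (\<open>component_lie_bracket\<close>).

  The differential calculus that this needs is of class \<open>C\<^sup>1\<close> and \<open>C\<^sup>2\<close> only: if the multiplication of \<open>G\<close>
  is \<open>C\<^sup>2\<close> in charts, then that of \<open>TG\<close> is \<open>C\<^sup>1\<close> in charts, and its tangent map can be computed. All
  identities between differentials are limits of identities between difference quotients for unit
  parameters tending to \<open>0\<close> (\<open>differential_eqI\<close>); the symmetry of the second differential is such a
  limit in two parameters. The tangent bundle is handled through chart changes: by the chain rule a
  tangent map sends the tangent vector with component \<open>v\<close> in one chart to the tangent vector whose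
  component in a second chart is the differential of the representative applied to \<open>v\<close>
  (\<open>tangent_map_tangent_vector\<close>).
\<close>

section \<open>Limits along the units\<close>

text \<open>Density of the units makes this filter nontrivial, so that limits along it are
  unique. It replaces the limit over nonzero parameters of real analysis: a unit can be
  cancelled in front of a difference quotient.\<close>

abbreviation units_to_0 :: "'k::smooth_base_ring filter" where
  "units_to_0 \<equiv> at 0 within {t. t dvd 1}"

lemma units_to_0_neq_bot [simp]: "(units_to_0 :: 'k::smooth_base_ring filter) \<noteq> bot"
proof -
  have "\<exists>y\<in>S. y dvd 1 \<and> y \<noteq> 0" if "open S" "0 \<in> S" for S :: "'k set"
  proof -
    from that obtain y where y: "y \<in> S" "y dvd 1" using dense_units[of S] by blast
    then have "y \<noteq> 0" by (metis dvd_0_left_iff zero_neq_one)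
    with y show ?thesis by blast
  qed
  then show ?thesis
    unfolding trivial_limit_def eventually_at_topological by (metis mem_Collect_eq)
qed

lemma eventually_units_to_0: "eventually (\<lambda>t::'k::smooth_base_ring. t dvd 1) units_to_0"
  unfolding eventually_at_topological by auto

lemma tendsto_id_units_to_0: "((\<lambda>t::'k::smooth_base_ring. t) \<longlongrightarrow> 0) units_to_0"
  by (rule tendsto_ident_at)

lemma tendsto_eventually_mem: "(f \<longlongrightarrow> l) F \<Longrightarrow> open U \<Longrightarrow> l \<in> U \<Longrightarrow> eventually (\<lambda>i. f i \<in> U) F"
  by (rule topological_tendstoD)

lemma topological_module_simps:
  assumes "topological_module s"
  shows "s a (x + y) = s a x + s a y" "s (a + b) x = s a x + s b x" "s a (s b x) = s (a * b) x"
    "s a (x - y) = s a x - s a y" "s a (- x) = - s a x" "s a 0 = 0" "s 0 x = 0" "s 1 x = x"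
proof -
  interpret topological_module s by fact
  show "s a (x + y) = s a x + s a y" "s (a + b) x = s a x + s b x" "s a (s b x) = s (a * b) x"
    "s a (x - y) = s a x - s a y" "s a (- x) = - s a x" "s a 0 = 0" "s 0 x = 0" "s 1 x = x"
    by (simp_all add: algebra_simps)
qed

lemma tendsto_scale:
  assumes "topological_module s" "(a \<longlongrightarrow> a0) F" "(x \<longlongrightarrow> x0) F"
  shows "((\<lambda>i. s (a i) (x i)) \<longlongrightarrow> s a0 x0) F"
proof -
  interpret topological_module s by fact
  have "isCont (\<lambda>(a, x). s a x) (a0, x0)"
    using continuous_scale by (simp add: continuous_on_eq_continuous_at)
  from isCont_tendsto_compose[OF this tendsto_Pair[OF assms(2,3)]] show ?thesis by simp
qed

lemma continuous_on_scale:
  assumes "topological_module s" "continuous_on S f" "continuous_on S g"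
  shows "continuous_on S (\<lambda>x. s (f x) (g x))"
  using assms(2,3) tendsto_scale[OF assms(1)] unfolding continuous_on_def by blast

lemma unit_scale_cancel:
  assumes "topological_module s" "t dvd 1" "s t x = s t y"
  shows "x = y"
proof -
  obtain r where "1 = t * r" using assms(2) by (auto elim: dvdE)
  then have "x = s r (s t x)" "y = s r (s t y)"
    by (simp_all add: topological_module_simps[OF assms(1)] mult.commute)
  then show ?thesis using assms(3) by simp
qed

lemma topological_module_mult: "topological_module ((*) :: 'k::smooth_base_ring \<Rightarrow> 'k \<Rightarrow> 'k)"
proof
  show "continuous_on UNIV (\<lambda>(a::'k, x). a * x)"
    unfolding case_prod_beta by (intro continuous_intros)
qed (simp_all add: algebra_simps)

lemma topological_module_prod_scale:
  assumes "topological_module s" "topological_module s'"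
  shows "topological_module (prod_scale s s')"
proof -
  have "continuous_on UNIV (\<lambda>(a, x). prod_scale s s' a x)"
    unfolding case_prod_beta prod_scale_def map_prod_def
    by (intro continuous_intros continuous_on_scale[OF assms(1)] continuous_on_scale[OF assms(2)])
  then show ?thesis
    by unfold_locales
      (simp_all add: prod_scale_def split_beta topological_module_simps[OF assms(1)]
        topological_module_simps[OF assms(2)] prod_eq_iff map_prod_def)
qed

lemma prod_scale_simp [simp]: "prod_scale s s' a (x, y) = (s a x, s' a y)"
  by (simp add: prod_scale_def)

section \<open>Maps of class \<open>C\<^sup>1\<close>\<close>

abbreviation extd where "extd s U \<equiv> ext_dom euclidean (+) s U"

lemma mem_ext_dom [simp]: "(x, v, t) \<in> extd s U \<longleftrightarrow> x \<in> U \<and> x + s t v \<in> U"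
  by (simp add: ext_dom_def)

lemma is_ext_euclidean:
  "is_ext euclidean (+) s s' U f g \<longleftrightarrow> continuous_on (extd s U) g \<and>
     (\<forall>x v t. x \<in> U \<longrightarrow> x + s t v \<in> U \<longrightarrow> f (x + s t v) - f x = s' t (g (x, v, t)))"
  unfolding is_ext_def by (auto simp: ext_dom_def)

definition C1_on ::
  "('k::smooth_base_ring \<Rightarrow> 'v::{topological_ab_group_add,t2_space} \<Rightarrow> 'v) \<Rightarrow>
   ('k \<Rightarrow> 'w::{topological_ab_group_add,t2_space} \<Rightarrow> 'w) \<Rightarrow> 'v set \<Rightarrow> ('v \<Rightarrow> 'w) \<Rightarrow> bool" where
  "C1_on s s' U f \<longleftrightarrow> open U \<and> (\<exists>g. is_ext euclidean (+) s s' U f g)"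

lemma C1_on_open: "C1_on s s' U f \<Longrightarrow> open U"
  by (simp add: C1_on_def)

lemma tendsto_step:
  assumes "topological_module s" "(a \<longlongrightarrow> x) F" "(v \<longlongrightarrow> w) F" "(t \<longlongrightarrow> r) F"
  shows "((\<lambda>i. a i + s (t i) (v i)) \<longlongrightarrow> x + s r w) F"
  by (intro tendsto_add tendsto_scale[OF assms(1)] assms)

lemma open_ext_dom:
  assumes "topological_module s" "open U"
  shows "open (extd s U)"
proof -
  let ?h = "\<lambda>z. fst z + s (snd (snd z)) (fst (snd z))"
  have "continuous_on UNIV ?h"
    by (intro continuous_intros continuous_on_scale[OF assms(1)])
  then have "open (?h -` U)" "open (fst -` U :: ('b \<times> 'b \<times> 'a) set)"
    using assms(2) by (auto intro: open_vimage open_vimage_fst)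
  moreover have "extd s U = fst -` U \<inter> ?h -` U" by (auto simp: ext_dom_def)
  ultimately show ?thesis by auto
qed

lemma tendsto_ext:
  assumes "topological_module s" "open U" "is_ext euclidean (+) s s' U f g"
    and "(a \<longlongrightarrow> x) F" "(b \<longlongrightarrow> v) F" "(c \<longlongrightarrow> t) F" "x \<in> U" "x + s t v \<in> U"
  shows "((\<lambda>i. g (a i, b i, c i)) \<longlongrightarrow> g (x, v, t)) F"
proof -
  have "isCont g (x, v, t)"
    using open_ext_dom[OF assms(1,2)] assms(3,7,8)
    by (auto simp: is_ext_euclidean continuous_on_eq_continuous_at)
  from isCont_tendsto_compose[OF this tendsto_Pair[OF assms(4) tendsto_Pair[OF assms(5,6)]]]
  show ?thesis .
qed

text \<open>Continuity is read off from the extension at parameter \<open>1\<close>, where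
  \<open>f y = f x + f\<^sup>[\<^sup>1\<^sup>](x, y - x, 1)\<close>.\<close>

lemma C1_on_continuous:
  assumes m: "topological_module s" "topological_module s'" and f: "C1_on s s' U f" and x: "x \<in> U"
    and a: "(a \<longlongrightarrow> x) F"
  shows "((\<lambda>i. f (a i)) \<longlongrightarrow> f x) F"
proof -
  note ms = topological_module_simps[OF m(1)] topological_module_simps[OF m(2)]
  from f obtain g where U: "open U" and g: "is_ext euclidean (+) s s' U f g" by (auto simp: C1_on_def)
  have e: "f (a i) = f x + g (x, a i - x, 1)" if "a i \<in> U" for i
    using g x that unfolding is_ext_euclidean
    by (metis (no_types, lifting) add.commute diff_add_cancel topological_module_simps(8)[OF m(1)]
      topological_module_simps(8)[OF m(2)])
  have "((\<lambda>i. g (x, a i - x, 1)) \<longlongrightarrow> g (x, 0, 1)) F"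
    using x by (intro tendsto_ext[OF m(1) U g]) (auto intro!: tendsto_eq_intros a simp: ms)
  moreover have "g (x, 0, 1) = 0"
    using g x unfolding is_ext_euclidean
    by (metis add.right_neutral diff_self topological_module_simps(6,8)[OF m(1)]
      topological_module_simps(6,8)[OF m(2)])
  ultimately have "((\<lambda>i. f x + g (x, a i - x, 1)) \<longlongrightarrow> f x) F"
    by (auto intro!: tendsto_eq_intros)
  moreover have "eventually (\<lambda>i. f x + g (x, a i - x, 1) = f (a i)) F"
    using tendsto_eventually_mem[OF a U x] e by (auto elim: eventually_mono)
  ultimately show ?thesis by (rule Lim_transform_eventually)
qed

lemma tendsto_line:
  assumes "topological_module s"
  shows "((\<lambda>t. x + s t v) \<longlongrightarrow> x) units_to_0"
  using tendsto_step[OF assms tendsto_const tendsto_const tendsto_id_units_to_0, of x v]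
  by (simp add: topological_module_simps[OF assms])

text \<open>The basic tool for computing differentials: for unit \<open>t\<close> the difference
  quotient determines \<open>q t\<close>, hence any extension
  \<open>f\<^sup>[\<^sup>1\<^sup>]\<close> agrees with \<open>q\<close> along the units, and
  \<open>f\<^sup>[\<^sup>1\<^sup>](x, v, 0)\<close> is the limit of \<open>q\<close>. In
  particular this shows that the value does not depend on the extension.\<close>

lemma differential_eqI:
  assumes m: "topological_module s" "topological_module s'" and f: "C1_on s s' U f" and x: "x \<in> U"
    and lim: "(q \<longlongrightarrow> w) units_to_0"
    and eq: "eventually (\<lambda>t. f (x + s t v) - f x = s' t (q t)) units_to_0"
  shows "differential s s' U f x v = w"
proof -
  note ms = topological_module_simps[OF m(1)] topological_module_simps[OF m(2)]
  have U: "open U" using f by (rule C1_on_open)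
  have *: "g (x, v, 0) = w" if g: "is_ext euclidean (+) s s' U f g" for g
  proof -
    have 1: "((\<lambda>t. g (x, v, t)) \<longlongrightarrow> g (x, v, 0)) units_to_0"
      using x by (intro tendsto_ext[OF m(1) U g] tendsto_const tendsto_id_units_to_0)
        (auto simp: ms)
    have "eventually (\<lambda>t. q t = g (x, v, t)) units_to_0"
      using eq eventually_units_to_0 tendsto_eventually_mem[OF tendsto_line[OF m(1)] U x, of v]
    proof eventually_elim
      case (elim t)
      then have "s' t (q t) = s' t (g (x, v, t))" using g x by (auto simp: is_ext_euclidean)
      then show ?case using unit_scale_cancel[OF m(2)] elim by blast
    qed
    from Lim_transform_eventually[OF lim this] 1 show ?thesis
      using tendsto_unique units_to_0_neq_bot by blast
  qed
  from f obtain g where g: "is_ext euclidean (+) s s' U f g" by (auto simp: C1_on_def)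
  show ?thesis unfolding differential_def
    by (rule the_equality) (use * g in blast)+
qed

lemma differential_is_ext:
  assumes m: "topological_module s" "topological_module s'" and U: "open U"
    and g: "is_ext euclidean (+) s s' U f g" and x: "x \<in> U"
  shows "differential s s' U f x v = g (x, v, 0)"
proof (rule differential_eqI[OF m _ x])
  note ms = topological_module_simps[OF m(1)] topological_module_simps[OF m(2)]
  show "C1_on s s' U f" using U g by (auto simp: C1_on_def)
  show "((\<lambda>t. g (x, v, t)) \<longlongrightarrow> g (x, v, 0)) units_to_0"
    using x by (intro tendsto_ext[OF m(1) U g] tendsto_const tendsto_id_units_to_0)
      (auto simp: ms)
  show "eventually (\<lambda>t. f (x + s t v) - f x = s' t (g (x, v, t))) units_to_0"
    using tendsto_eventually_mem[OF tendsto_line[OF m(1)] U x, of v]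
    by eventually_elim (use g x in \<open>auto simp: is_ext_euclidean\<close>)
qed

lemma C1_onE:
  assumes m: "topological_module s" "topological_module s'" and f: "C1_on s s' U f"
  obtains g where "is_ext euclidean (+) s s' U f g"
    "\<And>x v. x \<in> U \<Longrightarrow> differential s s' U f x v = g (x, v, 0)"
    "\<And>x v t. x \<in> U \<Longrightarrow> x + s t v \<in> U \<Longrightarrow> f (x + s t v) = f x + s' t (g (x, v, t))"
proof -
  from f obtain g where U: "open U" and g: "is_ext euclidean (+) s s' U f g" by (auto simp: C1_on_def)
  show ?thesis
  proof (rule that[OF g])
    show "f (x + s t v) = f x + s' t (g (x, v, t))" if "x \<in> U" "x + s t v \<in> U" for x v t
      using g that by (auto simp: is_ext_euclidean algebra_simps)
  qed (rule differential_is_ext[OF m U g])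
qed

lemma C1_on_subset:
  assumes "C1_on s s' U f" "open U'" "U' \<subseteq> U"
  shows "C1_on s s' U' f"
proof -
  have "extd s U' \<subseteq> extd s U" using assms(3) by (auto simp: ext_dom_def)
  then show ?thesis
    using assms continuous_on_subset unfolding C1_on_def is_ext_euclidean by (meson subsetD)
qed

lemma C1_on_cong:
  assumes "C1_on s s' U f" "\<And>x. x \<in> U \<Longrightarrow> f x = f' x"
  shows "C1_on s s' U f'"
  using assms unfolding C1_on_def is_ext_euclidean by simp

text \<open>The composite is a separate map \<open>k\<close> with its own domain, and it needs
  to agree with \<open>h \<circ> f\<close> only where all three maps are defined; this is the
  form in which representatives in charts compose. The difference quotient of \<open>h \<circ>
  f\<close> is \<open>h\<^sup>[\<^sup>1\<^sup>](f x, f\<^sup>[\<^sup>1\<^sup>](x, v, t),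
  t)\<close>.\<close>

lemma differential_chain:
  assumes m: "topological_module s" "topological_module s'" "topological_module s''"
    and f: "C1_on s s' U f" and h: "C1_on s' s'' W h" and k: "C1_on s s'' Z k"
    and x: "x \<in> U" "f x \<in> W" "x \<in> Z"
    and eq: "\<And>y. y \<in> U \<Longrightarrow> y \<in> Z \<Longrightarrow> f y \<in> W \<Longrightarrow> k y = h (f y)"
  shows "differential s s'' Z k x v = differential s' s'' W h (f x) (differential s s' U f x v)"
proof -
  note ms = topological_module_simps[OF m(1)] topological_module_simps[OF m(2)]
    topological_module_simps[OF m(3)]
  obtain f1 where f1: "is_ext euclidean (+) s s' U f f1"
    "\<And>x v. x \<in> U \<Longrightarrow> differential s s' U f x v = f1 (x, v, 0)"
    "\<And>x v t. x \<in> U \<Longrightarrow> x + s t v \<in> U \<Longrightarrow> f (x + s t v) = f x + s' t (f1 (x, v, t))"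
    using C1_onE[OF m(1,2) f] by blast
  obtain h1 where h1: "is_ext euclidean (+) s' s'' W h h1"
    "\<And>x v. x \<in> W \<Longrightarrow> differential s' s'' W h x v = h1 (x, v, 0)"
    "\<And>x v t. x \<in> W \<Longrightarrow> x + s' t v \<in> W \<Longrightarrow> h (x + s' t v) = h x + s'' t (h1 (x, v, t))"
    using C1_onE[OF m(2,3) h] by blast
  have lim: "((\<lambda>t. f1 (x, v, t)) \<longlongrightarrow> f1 (x, v, 0)) units_to_0"
    using x by (intro tendsto_ext[OF m(1) C1_on_open[OF f] f1(1)] tendsto_const tendsto_id_units_to_0)
      (auto simp: ms)
  show ?thesis
  proof (rule differential_eqI[OF m(1,3) k x(3)])
    show "((\<lambda>t. h1 (f x, f1 (x, v, t), t)) \<longlongrightarrow>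
        differential s' s'' W h (f x) (differential s s' U f x v)) units_to_0"
      unfolding h1(2)[OF x(2)] f1(2)[OF x(1)] using x
      by (intro tendsto_ext[OF m(2) C1_on_open[OF h] h1(1)] tendsto_const tendsto_id_units_to_0 lim)
        (auto simp: ms)
    note line = tendsto_line[OF m(1), of x v]
    show "eventually (\<lambda>t. k (x + s t v) - k x = s'' t (h1 (f x, f1 (x, v, t), t))) units_to_0"
      using tendsto_eventually_mem[OF line C1_on_open[OF f] x(1)]
        tendsto_eventually_mem[OF line C1_on_open[OF k] x(3)]
        tendsto_eventually_mem[OF C1_on_continuous[OF m(1,2) f x(1) line] C1_on_open[OF h] x(2)]
      by eventually_elim (use x eq f1(3) h1(3) in auto)
  qed
qed

lemma differential_local:
  assumes m: "topological_module s" "topological_module s'"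
    and f: "C1_on s s' U f" "C1_on s s' U' f'" and x: "x \<in> U" "x \<in> U'"
    and eq: "\<And>y. y \<in> U \<Longrightarrow> y \<in> U' \<Longrightarrow> f y = f' y"
  shows "differential s s' U f x v = differential s s' U' f' x v"
proof -
  note ms = topological_module_simps[OF m(1)] topological_module_simps[OF m(2)]
  obtain g where g: "is_ext euclidean (+) s s' U' f' g"
    "\<And>x v. x \<in> U' \<Longrightarrow> differential s s' U' f' x v = g (x, v, 0)"
    "\<And>x v t. x \<in> U' \<Longrightarrow> x + s t v \<in> U' \<Longrightarrow> f' (x + s t v) = f' x + s' t (g (x, v, t))"
    using C1_onE[OF m f(2)] by blast
  note line = tendsto_line[OF m(1), of x v]
  show ?thesis
  proof (rule differential_eqI[OF m f(1) x(1)])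
    show "((\<lambda>t. g (x, v, t)) \<longlongrightarrow> differential s s' U' f' x v) units_to_0"
      unfolding g(2)[OF x(2)]
      using x by (intro tendsto_ext[OF m(1) C1_on_open[OF f(2)] g(1)] tendsto_const tendsto_id_units_to_0)
        (auto simp: ms)
    show "eventually (\<lambda>t. f (x + s t v) - f x = s' t (g (x, v, t))) units_to_0"
      using tendsto_eventually_mem[OF line C1_on_open[OF f(1)] x(1)]
        tendsto_eventually_mem[OF line C1_on_open[OF f(2)] x(2)]
      by eventually_elim (use x eq g(3) in auto)
  qed
qed

text \<open>The step in direction \<open>v + w\<close> is a step in direction \<open>v\<close>
  followed by one in direction \<open>w\<close>, whose base point \<open>x + tv\<close> tends to
  \<open>x\<close>.\<close>

lemma differential_add:
  assumes m: "topological_module s" "topological_module s'" and f: "C1_on s s' U f" and x: "x \<in> U"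
  shows "differential s s' U f x (v + w) = differential s s' U f x v + differential s s' U f x w"
proof -
  note ms = topological_module_simps[OF m(1)] topological_module_simps[OF m(2)]
  obtain g where g: "is_ext euclidean (+) s s' U f g"
    "\<And>x v. x \<in> U \<Longrightarrow> differential s s' U f x v = g (x, v, 0)"
    "\<And>x v t. x \<in> U \<Longrightarrow> x + s t v \<in> U \<Longrightarrow> f (x + s t v) = f x + s' t (g (x, v, t))"
    using C1_onE[OF m f] by blast
  note lim = tendsto_ext[OF m(1) C1_on_open[OF f] g(1) _ _ tendsto_id_units_to_0]
  show ?thesis
  proof (rule differential_eqI[OF m f x])
    show "((\<lambda>t. g (x, v, t) + g (x + s t v, w, t)) \<longlongrightarrow>
        differential s s' U f x v + differential s s' U f x w) units_to_0"
      unfolding g(2)[OF x]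
      by (intro tendsto_add lim tendsto_const tendsto_line[OF m(1)])
        (use x in \<open>auto simp: ms\<close>)
    show "eventually (\<lambda>t. f (x + s t (v + w)) - f x = s' t (g (x, v, t) + g (x + s t v, w, t)))
      units_to_0"
      using tendsto_eventually_mem[OF tendsto_line[OF m(1), of x v] C1_on_open[OF f] x]
        tendsto_eventually_mem[OF tendsto_line[OF m(1), of x "v + w"] C1_on_open[OF f] x]
    proof eventually_elim
      case (elim t)
      have "f (x + s t v + s t w) = f (x + s t v) + s' t (g (x + s t v, w, t))"
        using elim by (intro g(3)) (auto simp: ms add.assoc)
      then show ?case using g(3)[OF x, of t v] elim by (simp add: ms add.assoc)
    qed
  qed
qed

lemma differential_0:
  assumes "topological_module s" "topological_module s'" "C1_on s s' U f" "x \<in> U"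
  shows "differential s s' U f x 0 = 0"
  using differential_add[OF assms, of 0 0] by simp

text \<open>A step of length \<open>t\<close> in direction \<open>rv\<close> is a step of length
  \<open>tr\<close> in direction \<open>v\<close>.\<close>

lemma differential_scale:
  assumes m: "topological_module s" "topological_module s'" and f: "C1_on s s' U f" and x: "x \<in> U"
  shows "differential s s' U f x (s r v) = s' r (differential s s' U f x v)"
proof -
  note ms = topological_module_simps[OF m(1)] topological_module_simps[OF m(2)]
  obtain g where g: "is_ext euclidean (+) s s' U f g"
    "\<And>x v. x \<in> U \<Longrightarrow> differential s s' U f x v = g (x, v, 0)"
    "\<And>x v t. x \<in> U \<Longrightarrow> x + s t v \<in> U \<Longrightarrow> f (x + s t v) = f x + s' t (g (x, v, t))"
    using C1_onE[OF m f] by blast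
  have lim0: "((\<lambda>t. t * r) \<longlongrightarrow> 0) units_to_0"
    by (auto intro!: tendsto_eq_intros)
  show ?thesis
  proof (rule differential_eqI[OF m f x])
    show "((\<lambda>t. s' r (g (x, v, t * r))) \<longlongrightarrow> s' r (differential s s' U f x v)) units_to_0"
      unfolding g(2)[OF x]
      by (intro tendsto_scale[OF m(2)] tendsto_ext[OF m(1) C1_on_open[OF f] g(1)] lim0 tendsto_const)
        (use x in \<open>auto simp: ms\<close>)
    show "eventually (\<lambda>t. f (x + s t (s r v)) - f x = s' t (s' r (g (x, v, t * r)))) units_to_0"
      using tendsto_eventually_mem[OF tendsto_line[OF m(1), of x "s r v"] C1_on_open[OF f] x]
      by eventually_elim (use x g(3) in \<open>simp add: ms\<close>)
  qed
qed

text \<open>If \<open>f\<close> is affine along the line \<open>x + tv\<close>, then the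
  difference quotient is constant.\<close>

lemma differential_eq_linear:
  assumes m: "topological_module s" "topological_module s'" and f: "C1_on s s' U f" and x: "x \<in> U"
    and lin: "\<And>t. x + s t v \<in> U \<Longrightarrow> f (x + s t v) = f x + s' t w"
  shows "differential s s' U f x v = w"
proof (rule differential_eqI[OF m f x tendsto_const])
  show "eventually (\<lambda>t. f (x + s t v) - f x = s' t w) units_to_0"
    using tendsto_eventually_mem[OF tendsto_line[OF m(1), of x v] C1_on_open[OF f] x]
    by eventually_elim (simp add: lin)
qed

text \<open>Composition with an affine map \<open>L\<close> with linear part \<open>L'\<close>.
  It covers projections, rearrangements of factors, and the insertion of a constant into one
  argument.\<close>

lemma C1_on_affine:
  assumes m: "topological_module s" "topological_module s0" "topological_module s'"
    and f: "C1_on s0 s' U f"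
    and cont: "continuous_on UNIV L" "continuous_on UNIV L'"
    and lin: "\<And>x v t. L (x + s t v) = L x + s0 t (L' v)"
  shows "C1_on s s' (L -` U) (\<lambda>x. f (L x))"
    and "L x \<in> U \<Longrightarrow> differential s s' (L -` U) (\<lambda>x. f (L x)) x v = differential s0 s' U f (L x) (L' v)"
proof -
  obtain g where g: "is_ext euclidean (+) s0 s' U f g"
    "\<And>x v. x \<in> U \<Longrightarrow> differential s0 s' U f x v = g (x, v, 0)"
    using C1_onE[OF m(2,3) f] by metis
  have o: "open (L -` U)" using cont(1) C1_on_open[OF f] by (simp add: open_vimage)
  have A: "continuous_on (extd s0 U) g" using g(1) by (simp add: is_ext_euclidean)
  have B: "continuous_on (extd s (L -` U)) (\<lambda>z. (L (fst z), L' (fst (snd z)), snd (snd z)))"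
    by (intro continuous_intros continuous_on_compose2[OF cont(1)] continuous_on_compose2[OF
      cont(2)]) auto
  have C: "(\<lambda>z. (L (fst z), L' (fst (snd z)), snd (snd z))) ` extd s (L -` U) \<subseteq> extd s0 U"
    using lin by (auto simp: ext_dom_def)
  note continuous_on_compose2[OF A B C]
  then have *: "is_ext euclidean (+) s s' (L -` U) (\<lambda>x. f (L x))
      (\<lambda>z. g (L (fst z), L' (fst (snd z)), snd (snd z)))"
    using g(1) lin by (simp add: is_ext_euclidean)
  with o show "C1_on s s' (L -` U) (\<lambda>x. f (L x))" by (auto simp: C1_on_def)
  show "differential s s' (L -` U) (\<lambda>x. f (L x)) x v = differential s0 s' U f (L x) (L' v)" if "L x \<in> U"
    using differential_is_ext[OF m(1,3) o *, of x v] g(2) that by simp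
qed

lemma C1_on_Pair:
  assumes m: "topological_module s" "topological_module s1" "topological_module s2"
    and f: "C1_on s s1 U f1" "C1_on s s2 U f2"
  shows "C1_on s (prod_scale s1 s2) U (\<lambda>x. (f1 x, f2 x))"
    and "x \<in> U \<Longrightarrow> differential s (prod_scale s1 s2) U (\<lambda>x. (f1 x, f2 x)) x v =
      (differential s s1 U f1 x v, differential s s2 U f2 x v)"
proof -
  have o: "open U" using f by (simp add: C1_on_def)
  obtain g1 where g1: "is_ext euclidean (+) s s1 U f1 g1"
    "\<And>x v. x \<in> U \<Longrightarrow> differential s s1 U f1 x v = g1 (x, v, 0)"
    using C1_onE[OF m(1,2) f(1)] by metis
  obtain g2 where g2: "is_ext euclidean (+) s s2 U f2 g2"
    "\<And>x v. x \<in> U \<Longrightarrow> differential s s2 U f2 x v = g2 (x, v, 0)"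
    using C1_onE[OF m(1,3) f(2)] by metis
  have *: "is_ext euclidean (+) s (prod_scale s1 s2) U (\<lambda>x. (f1 x, f2 x)) (\<lambda>z. (g1 z, g2 z))"
    using g1(1) g2(1) by (auto simp: is_ext_euclidean intro: continuous_on_Pair)
  with o show "C1_on s (prod_scale s1 s2) U (\<lambda>x. (f1 x, f2 x))" by (auto simp: C1_on_def)
  show "differential s (prod_scale s1 s2) U (\<lambda>x. (f1 x, f2 x)) x v =
      (differential s s1 U f1 x v, differential s s2 U f2 x v)" if "x \<in> U"
    using differential_is_ext[OF m(1) topological_module_prod_scale[OF m(2,3)] o *] g1(2) g2(2) that
      by simp
qed

section \<open>Maps of class \<open>C\<^sup>2\<close> and their second differential\<close>

text \<open>The scalar multiplication of \<open>V \<times> V \<times> K\<close>, the module that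
  contains the domain of \<open>f\<^sup>[\<^sup>1\<^sup>]\<close>.\<close>

abbreviation step_scale where "step_scale s \<equiv> prod_scale s (prod_scale s (*))"

definition C2_on ::
  "('k::smooth_base_ring \<Rightarrow> 'v::{topological_ab_group_add,t2_space} \<Rightarrow> 'v) \<Rightarrow>
   ('k \<Rightarrow> 'w::{topological_ab_group_add,t2_space} \<Rightarrow> 'w) \<Rightarrow> 'v set \<Rightarrow> ('v \<Rightarrow> 'w) \<Rightarrow> bool" where
  "C2_on s s' U f \<longleftrightarrow> open U \<and>
     (\<exists>g. is_ext euclidean (+) s s' U f g \<and> C1_on (step_scale s) s' (extd s U) g)"

lemma C2_on_imp_C1_on: "C2_on s s' U f \<Longrightarrow> C1_on s s' U f"
  by (auto simp: C2_on_def C1_on_def)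

lemma is_extD:
  "is_ext euclidean (+) s s' U f g \<Longrightarrow> x \<in> U \<Longrightarrow> x + s t v \<in> U \<Longrightarrow> f (x + s t v) - f x = s' t (g (x, v, t))"
  by (simp add: is_ext_euclidean)

text \<open>Pulling back along a continuous additive map \<open>e\<close> of the source. Applied
  to the embeddings of \<open>V\<close> and of \<open>V \<times> V \<times> K\<close> into the
  trees of depth \<open>0\<close> and \<open>1\<close>, it brings the calculus on trees back to
  ordinary product types.\<close>

lemma is_ext_transfer:
  fixes e :: "'v::{topological_ab_group_add,t2_space} \<Rightarrow> 't" and s :: "'k::smooth_base_ring \<Rightarrow> 'v \<Rightarrow> 'v"
  assumes e: "continuous_map euclidean T e" "\<And>x y. e (x + y) = add (e x) (e y)"
      "\<And>a x. e (s a x) = s1 a (e x)"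
    and ext: "is_ext T add s1 s' U' f g" and U: "e ` U \<subseteq> U'"
  shows "is_ext euclidean (+) s s' U (f \<circ> e) (\<lambda>(x, v, t). g (e x, e v, t))"
proof -
  let ?E = "\<lambda>z::'v \<times> 'v \<times> 'k. (e (fst z), e (fst (snd z)), snd (snd z))"
  have top: "e x \<in> topspace T" for x
    using continuous_map_image_subset_topspace[OF e(1)] by auto
  have proj: "continuous_map euclidean euclidean (\<lambda>z::'v \<times> 'v \<times> 'k. fst z)"
    "continuous_map euclidean euclidean (\<lambda>z::'v \<times> 'v \<times> 'k. fst (snd z))"
    "continuous_map euclidean euclidean (\<lambda>z::'v \<times> 'v \<times> 'k. snd (snd z))"
    by (auto intro!: continuous_intros)
  have "continuous_map euclidean (prod_topology T (prod_topology T euclidean)) ?E"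
    using continuous_map_compose[OF proj(1) e(1)] continuous_map_compose[OF proj(2) e(1)] proj(3)
    by (auto simp: continuous_map_pairwise o_def)
  moreover have "?E z \<in> ext_dom T add s1 U'" if "z \<in> extd s U" for z
    using that U top by (auto simp: ext_dom_def simp flip: e(2,3))
  ultimately have "continuous_map (top_of_set (extd s U))
      (subtopology (prod_topology T (prod_topology T euclidean)) (ext_dom T add s1 U')) ?E"
    by (auto simp: continuous_map_in_subtopology intro: continuous_map_from_subtopology)
  then have "continuous_map (top_of_set (extd s U)) euclidean (g \<circ> ?E)"
    using ext unfolding is_ext_def by (blast intro: continuous_map_compose)
  moreover have "f (e (x + s t v)) - f (e x) = s' t (g (e x, e v, t))" if "x \<in> U" "x + s t v \<in> U"
    for x v t
  proof -
    have "add (e x) (s1 t (e v)) \<in> U'" "e x \<in> U'"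
      using that U by (auto simp flip: e(2,3))
    then have "(e x, e v, t) \<in> ext_dom T add s1 U'" using top by (auto simp: ext_dom_def)
    then show ?thesis using ext by (auto simp: is_ext_def e(2,3))
  qed
  ultimately show ?thesis
    by (simp add: is_ext_euclidean o_def case_prod_beta)
qed

lemma continuous_map_Pt: "continuous_map euclidean (tree_top 0) Pt"
  by (simp, rule continuous_map_pullback') (auto simp: o_def)

lemma continuous_map_Step:
  "continuous_map euclidean (tree_top (Suc 0))
     (\<lambda>(x::'v::topological_space, v, t::'k::topological_space). Step (Pt x) (Pt v) t)"
proof -
  have top: "Pt x \<in> topspace (tree_top 0)" for x :: 'v
    using continuous_map_image_subset_topspace[OF continuous_map_Pt] by auto
  have proj: "continuous_map euclidean euclidean (\<lambda>z::'v \<times> 'v \<times> 'k. fst z)"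
    "continuous_map euclidean euclidean (\<lambda>z::'v \<times> 'v \<times> 'k. fst (snd z))"
    "continuous_map euclidean euclidean (\<lambda>z::'v \<times> 'v \<times> 'k. snd (snd z))"
    by (auto intro!: continuous_intros)
  have "continuous_map euclidean (prod_topology (tree_top 0) (prod_topology (tree_top 0) euclidean))
      ((\<lambda>z. (base z, dir z, par z)) \<circ> (\<lambda>(x::'v, v, t::'k). Step (Pt x) (Pt v) t))"
    using continuous_map_compose[OF proj(1) continuous_map_Pt]
      continuous_map_compose[OF proj(2) continuous_map_Pt] proj(3)
    by (auto simp: continuous_map_pairwise o_def case_prod_beta simp del: tree_top.simps)
  then show ?thesis
    unfolding tree_top.simps(2)
    by (rule continuous_map_pullback') (use top in \<open>force simp: image_iff simp del: tree_top.simps\<close>)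
qed

lemma smooth_on_imp_C2_on:
  assumes m: "topological_module s" and "smooth_on s s' U f"
  shows "C2_on s s' U f"
proof -
  let ?S = "\<lambda>(x, v, t). Step x v t"
  have U: "open U" and "Cj_tree s s' (Suc (Suc 0)) 0 (Pt ` U) (f \<circ> pt)"
    using assms(2) unfolding smooth_on_def Cj_on_def by blast+
  then obtain g h where
    g: "is_ext (tree_top 0) tree_plus (tree_scale s) s' (Pt ` U) (f \<circ> pt) g" and
    h: "is_ext (tree_top (Suc 0)) tree_plus (tree_scale s) s'
      (?S ` ext_dom (tree_top 0) tree_plus (tree_scale s) (Pt ` U)) (\<lambda>z. g (base z, dir z, par z)) h"
    unfolding Cj_tree.simps by blast
  have top: "Pt x \<in> topspace (tree_top 0)" for x :: 'b
    using continuous_map_image_subset_topspace[OF continuous_map_Pt] by auto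
  have 1: "is_ext euclidean (+) s s' U f (\<lambda>(x, v, t). g (Pt x, Pt v, t))"
    using is_ext_transfer[OF continuous_map_Pt _ _ g, where s = s and U = U]
    by (simp add: o_def)
  have "(Pt x, Pt v, t) \<in> ext_dom (tree_top 0) tree_plus (tree_scale s) (Pt ` U)"
    if "(x, v, t) \<in> extd s U" for x v t
    using that top by (auto simp: ext_dom_def simp del: tree_top.simps)
  then have sub: "(\<lambda>(x, v, t). Step (Pt x) (Pt v) t) ` extd s U \<subseteq>
      ?S ` ext_dom (tree_top 0) tree_plus (tree_scale s) (Pt ` U)"
    by (force simp: image_iff simp del: tree_top.simps)
  have "is_ext euclidean (+) (step_scale s) s' (extd s U)
      ((\<lambda>z. g (base z, dir z, par z)) \<circ> (\<lambda>(x, v, t). Step (Pt x) (Pt v) t))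
      (\<lambda>(x, v, t). h (case x of (x, v, t) \<Rightarrow> Step (Pt x) (Pt v) t, case v of (x, v, t) \<Rightarrow> Step (Pt x)
        (Pt v) t, t))"
    by (rule is_ext_transfer[OF continuous_map_Step _ _ h sub]) auto
  moreover have "(\<lambda>z. g (base z, dir z, par z)) \<circ> (\<lambda>(x, v, t). Step (Pt x) (Pt v) t)
    = (\<lambda>(x, v, t). g (Pt x, Pt v, t))"
    by auto
  ultimately show ?thesis
    using 1 U open_ext_dom[OF m U] unfolding C2_on_def C1_on_def by auto
qed

text \<open>\<open>df(x)v\<close> is the extension \<open>f\<^sup>[\<^sup>1\<^sup>]\<close>
  composed with the linear map \<open>(x, v) \<mapsto> (x, v, 0)\<close>.\<close>

lemma C2_on_differential:
  assumes m: "topological_module s" "topological_module s'" and f: "C2_on s s' U f"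
  shows "C1_on (prod_scale s s) s' (U \<times> UNIV) (\<lambda>z. differential s s' U f (fst z) (snd z))"
proof -
  note ms = topological_module_simps[OF m(1)]
  note m3 = topological_module_prod_scale[OF m(1) topological_module_prod_scale[OF m(1)
    topological_module_mult]]
  obtain g where U: "open U" and g: "is_ext euclidean (+) s s' U f g"
    and g1: "C1_on (step_scale s) s' (extd s U) g"
    using f by (auto simp: C2_on_def)
  let ?L = "\<lambda>z::'b \<times> 'b. (fst z, snd z, 0::'a)"
  have "C1_on (prod_scale s s) s' (?L -` extd s U) (\<lambda>z. g (?L z))"
    by (rule C1_on_affine[OF topological_module_prod_scale[OF m(1,1)] m3 m(2) g1, where L' = ?L])
      (auto intro!: continuous_intros simp: prod_scale_def)
  moreover have "?L -` extd s U = U \<times> UNIV" by (auto simp: ext_dom_def ms)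
  ultimately show ?thesis
    using differential_is_ext[OF m U g] by (auto elim!: C1_on_cong)
qed

text \<open>\<open>d\<^sup>2f(x)(v, w)\<close>: the derivative of \<open>y \<mapsto>
  df(y)v\<close> at \<open>x\<close> in direction \<open>w\<close>.\<close>

definition second_differential ::
  "('k::smooth_base_ring \<Rightarrow> 'v::{topological_ab_group_add,t2_space} \<Rightarrow> 'v) \<Rightarrow>
   ('k \<Rightarrow> 'w::{topological_ab_group_add,t2_space} \<Rightarrow> 'w) \<Rightarrow> 'v set \<Rightarrow> ('v \<Rightarrow> 'w) \<Rightarrow> 'v \<Rightarrow> 'v \<Rightarrow> 'v \<Rightarrow> 'w" where
  "second_differential s s' U f x v w = differential (prod_scale s s) s' (U \<times> UNIV)
     (\<lambda>z. differential s s' U f (fst z) (snd z)) (x, v) (w, 0)"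

lemma second_differential_ext:
  assumes m: "topological_module s" "topological_module s'" and f: "C2_on s s' U f" and x: "x \<in> U"
    and g: "is_ext euclidean (+) s s' U f g"
    and h: "is_ext euclidean (+) (step_scale s) s' (extd s U) g h"
  shows "second_differential s s' U f x v w = h ((x, v, 0), (w, 0, 0), 0)"
proof -
  note ms = topological_module_simps[OF m(1)]
  have m2: "topological_module (prod_scale s s)" by (intro topological_module_prod_scale m)
  have m3: "topological_module (step_scale s)"
    by (intro topological_module_prod_scale m topological_module_mult)
  have U: "open U" using f by (simp add: C2_on_def)
  have d: "differential s s' U f x v = g (x, v, 0)" if "x \<in> U" for x v
    by (rule differential_is_ext[OF m U g that])
  show ?thesis unfolding second_differential_def
  proof (rule differential_eqI[OF m2 m(2) C2_on_differential[OF m f]])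
    show "(x, v) \<in> U \<times> UNIV" using x by simp
    show "((\<lambda>t. h ((x, v, 0), (w, 0, 0), t)) \<longlongrightarrow> h ((x, v, 0), (w, 0, 0), 0)) units_to_0"
      by (intro tendsto_ext[OF m3 open_ext_dom[OF m(1) U] h] tendsto_const tendsto_id_units_to_0)
        (use x in \<open>auto simp: ms\<close>)
    show "\<forall>\<^sub>F t in units_to_0.
       differential s s' U f (fst ((x, v) + prod_scale s s t (w, 0))) (snd ((x, v) + prod_scale s s
         t (w, 0))) -
       differential s s' U f (fst (x, v)) (snd (x, v)) = s' t (h ((x, v, 0), (w, 0, 0), t))"
      using tendsto_eventually_mem[OF tendsto_line[OF m(1), of x w] U x]
    proof eventually_elim
      case (elim t)
      have "g ((x, v, 0) + step_scale s t (w, 0, 0)) - g (x, v, 0) = s' t (h ((x, v, 0), (w, 0, 0), t))"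
        by (rule is_extD[OF h]) (use elim x in \<open>simp_all add: ms\<close>)
      then show ?case using elim x d by (simp add: ms)
    qed
  qed
qed

text \<open>The second difference \<open>f(x + tw + rv) - f(x + tw) - f(x + rv) + f x\<close> is
  symmetric in the two steps. For units \<open>t\<close> and \<open>r\<close>, dividing it by
  \<open>tr\<close> in the two possible orders gives values of
  \<open>f\<^sup>[\<^sup>2\<^sup>]\<close> which tend to the two sides when \<open>(t,
  r)\<close> tends to \<open>(0, 0)\<close>.\<close>

lemma second_differential_sym:
  assumes m: "topological_module s" "topological_module s'" and f: "C2_on s s' U f" and x: "x \<in> U"
  shows "second_differential s s' U f x v w = second_differential s s' U f x w v"
proof -
  note ms = topological_module_simps[OF m(1)] topological_module_simps[OF m(2)]
  have m3: "topological_module (step_scale s)"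
    by (intro topological_module_prod_scale m topological_module_mult)
  obtain g h where U: "open U" and g: "is_ext euclidean (+) s s' U f g"
    and h: "is_ext euclidean (+) (step_scale s) s' (extd s U) g h"
    using f by (auto simp: C2_on_def C1_on_def)
  let ?F = "(units_to_0 :: 'a filter) \<times>\<^sub>F (units_to_0 :: 'a filter)"
  have F: "?F \<noteq> bot" by (simp add: prod_filter_eq_bot)
  have ts: "(fst \<longlongrightarrow> (0::'a)) ?F" "(snd \<longlongrightarrow> (0::'a)) ?F"
    using filterlim_compose[OF tendsto_id_units_to_0 filterlim_fst]
      filterlim_compose[OF tendsto_id_units_to_0 filterlim_snd] by auto
  note lim = tendsto_ext[OF m3 open_ext_dom[OF m(1) U] h]
  have 1: "((\<lambda>p. h ((x, v, snd p), (w, 0, 0), fst p)) \<longlongrightarrow> h ((x, v, 0), (w, 0, 0), 0)) ?F"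
    by (intro lim tendsto_Pair tendsto_const ts) (use x in \<open>auto simp: ms\<close>)
  have 2: "((\<lambda>p. h ((x, w, fst p), (v, 0, 0), snd p)) \<longlongrightarrow> h ((x, w, 0), (v, 0, 0), 0)) ?F"
    by (intro lim tendsto_Pair tendsto_const ts) (use x in \<open>auto simp: ms\<close>)
  have line: "((\<lambda>p. x + s (fst p) w) \<longlongrightarrow> x + s 0 w) ?F" "((\<lambda>p. x + s (snd p) v) \<longlongrightarrow> x + s 0 v) ?F"
    "((\<lambda>p. (x + s (fst p) w) + s (snd p) v) \<longlongrightarrow> (x + s 0 w) + s 0 v) ?F"
    by (intro tendsto_step[OF m(1)] tendsto_const ts)+
  have base: "x + s 0 w \<in> U" "x + s 0 v \<in> U" "(x + s 0 w) + s 0 v \<in> U"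
    using x by (simp_all add: ms)
  have units: "eventually (\<lambda>p. fst p dvd 1 \<and> snd p dvd 1) ?F"
    using eventually_prodI[OF eventually_units_to_0 eventually_units_to_0] by simp
  have "eventually (\<lambda>p. h ((x, v, snd p), (w, 0, 0), fst p) = h ((x, w, fst p), (v, 0, 0), snd p)) ?F"
    using tendsto_eventually_mem[OF line(1) U base(1)] tendsto_eventually_mem[OF line(2) U base(2)]
      tendsto_eventually_mem[OF line(3) U base(3)] units
  proof eventually_elim
    case (elim p)
    obtain t r where p: "p = (t, r)" by (cases p)
    have in_U: "x + s t w \<in> U" "x + s r v \<in> U" "x + s t w + s r v \<in> U" "x + s r v + s t w \<in> U"
      using elim x by (auto simp: p ms add_ac)
    \<comment> \<open>\<open>h = f\<^sup>[\<^sup>2\<^sup>]\<close> with the outer step moving only the base point\<close>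
    have "s' t (h ((x, v, r), (w, 0, 0), t)) = g (x + s t w, v, r) - g (x, v, r)"
      using is_extD[OF h, of "(x, v, r)" t "(w, 0, 0)"] in_U x by (simp add: ms)
    then have "s' (r * t) (h ((x, v, r), (w, 0, 0), t)) =
        s' r (g (x + s t w, v, r)) - s' r (g (x, v, r))"
      by (metis ms(11,12))
    also have "\<dots> = (f (x + s t w + s r v) - f (x + s t w)) - (f (x + s r v) - f x)"
      using is_extD[OF g] in_U x by simp
    also have "\<dots> = (f (x + s r v + s t w) - f (x + s r v)) - (f (x + s t w) - f x)"
      by (simp add: algebra_simps)
    also have "\<dots> = s' t (g (x + s r v, w, t)) - s' t (g (x, w, t))"
      using is_extD[OF g] in_U x by simp
    also have "\<dots> = s' t (g (x + s r v, w, t) - g (x, w, t))"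
      by (simp add: ms)
    also have "g (x + s r v, w, t) - g (x, w, t) = s' r (h ((x, w, t), (v, 0, 0), r))"
      using is_extD[OF h, of "(x, w, t)" r "(v, 0, 0)"] in_U x by (simp add: ms)
    finally have "s' (r * t) (h ((x, v, r), (w, 0, 0), t)) = s' (r * t) (h ((x, w, t), (v, 0, 0), r))"
      by (simp add: ms mult.commute)
    moreover have "r * t dvd 1" using elim mult_dvd_mono[of r 1 t 1] by (simp add: p)
    ultimately show ?case using unit_scale_cancel[OF m(2)] by (auto simp: p)
  qed
  from tendsto_unique[OF F Lim_transform_eventually[OF 1 this] 2]
  show ?thesis by (simp add: second_differential_ext[OF m f x g h])
qed

text \<open>Additivity in the direction is that of a differential; symmetry carries it over to
  the other argument.\<close>

lemma second_differential_add:
  assumes m: "topological_module s" "topological_module s'" and f: "C2_on s s' U f" and x: "x \<in> U"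
  shows "second_differential s s' U f x v (w + w') =
      second_differential s s' U f x v w + second_differential s s' U f x v w'"
    and "second_differential s s' U f x (v + v') w =
      second_differential s s' U f x v w + second_differential s s' U f x v' w"
proof -
  have *: "second_differential s s' U f x v (w + w') =
      second_differential s s' U f x v w + second_differential s s' U f x v w'" for v w w'
    using differential_add[OF topological_module_prod_scale[OF m(1,1)] m(2) C2_on_differential[OF m f],
        of "(x, v)" "(w, 0)" "(w', 0)"] x
    by (simp add: second_differential_def)
  show "second_differential s s' U f x v (w + w') =
      second_differential s s' U f x v w + second_differential s s' U f x v w'" by (rule *)
  show "second_differential s s' U f x (v + v') w =
      second_differential s s' U f x v w + second_differential s s' U f x v' w"
    using *[of w v v'] by (simp add: second_differential_sym[OF m f x, of _ w])
qed

lemma second_differential_eq_0: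
  assumes m: "topological_module s" "topological_module s'" and f: "C2_on s s' U f" and x: "x \<in> U"
    and const: "\<And>t. x + s t w \<in> U \<Longrightarrow> differential s s' U f (x + s t w) v = differential s s' U f x v"
  shows "second_differential s s' U f x v w = 0"
  unfolding second_differential_def
  by (rule differential_eq_linear[OF topological_module_prod_scale[OF m(1,1)] m(2)
    C2_on_differential[OF m f]])
    (use x const in \<open>auto simp: topological_module_simps[OF m(1)] topological_module_simps[OF m(2)]\<close>)

text \<open>The tangent map \<open>(x, v) \<mapsto> (f x, df(x)v)\<close> in coordinates is
  \<open>C\<^sup>1\<close>, and its differential is the second tangent map of \<open>f\<close>.
  The term \<open>df(x)u\<close> appears because \<open>df(x)\<close> is linear.\<close>

lemma C1_on_tangent:
  assumes m: "topological_module s" "topological_module s'" and f: "C2_on s s' U f"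
  shows "C1_on (prod_scale s s) (prod_scale s' s') (U \<times> UNIV)
      (\<lambda>z. (f (fst z), differential s s' U f (fst z) (snd z)))"
    and "x \<in> U \<Longrightarrow> differential (prod_scale s s) (prod_scale s' s') (U \<times> UNIV)
      (\<lambda>z. (f (fst z), differential s s' U f (fst z) (snd z))) (x, v) (w, u) =
      (differential s s' U f x w, second_differential s s' U f x v w + differential s s' U f x u)"
proof -
  let ?df = "\<lambda>z. differential s s' U f (fst z) (snd z)"
  note ms = topological_module_simps[OF m(1)] topological_module_simps[OF m(2)]
  have m2: "topological_module (prod_scale s s)" by (intro topological_module_prod_scale m)
  note f1 = C2_on_imp_C1_on[OF f]
  note df = C2_on_differential[OF m f]
  have fst: "C1_on (prod_scale s s) s' (U \<times> UNIV) (\<lambda>z. f (fst z))"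
    and dfst: "x \<in> U \<Longrightarrow> differential (prod_scale s s) s' (U \<times> UNIV) (\<lambda>z. f (fst z)) (x, v) (w, u) =
      differential s s' U f x w"
    using C1_on_affine[OF m2 m(1,2) f1, of fst fst]
    by (auto simp: prod_scale_def continuous_on_fst vimage_fst)
  note pair = C1_on_Pair[OF m2 m(2,2) fst df]
  show "C1_on (prod_scale s s) (prod_scale s' s') (U \<times> UNIV) (\<lambda>z. (f (fst z), ?df z))"
    by (rule pair)
  assume x: "x \<in> U"
  have "differential (prod_scale s s) s' (U \<times> UNIV) ?df (x, v) (0, u) = differential s s' U f x u"
    by (rule differential_eq_linear[OF m2 m(2) df])
      (use x in \<open>auto simp: ms differential_add[OF m f1] differential_scale[OF m f1]\<close>)
  then have "differential (prod_scale s s) s' (U \<times> UNIV) ?df (x, v) (w, u) =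
      second_differential s s' U f x v w + differential s s' U f x u"
    using differential_add[OF m2 m(2) df, of "(x, v)" "(w, 0)" "(0, u)"] x
    by (simp add: second_differential_def)
  then show "differential (prod_scale s s) (prod_scale s' s') (U \<times> UNIV)
      (\<lambda>z. (f (fst z), ?df z)) (x, v) (w, u) =
      (differential s s' U f x w, second_differential s s' U f x v w + differential s s' U f x u)"
    using pair(2)[of "(x, v)" "(w, u)"] x by (simp add: dfst)
qed

section \<open>Maps in charts\<close>

lemma C1_on_map_prod:
  assumes m: "topological_module s" "topological_module s'" "topological_module s1"
    "topological_module s1'"
    and f: "C1_on s s1 U f" "C1_on s' s1' U' f'"
  shows "C1_on (prod_scale s s') (prod_scale s1 s1') (U \<times> U') (map_prod f f')"
    and "x \<in> U \<Longrightarrow> x' \<in> U' \<Longrightarrow>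
      differential (prod_scale s s') (prod_scale s1 s1') (U \<times> U') (map_prod f f') (x, x') (v, v') =
      (differential s s1 U f x v, differential s' s1' U' f' x' v')"
proof -
  have m2: "topological_module (prod_scale s s')" by (intro topological_module_prod_scale m)
  have o: "open (U \<times> U')" using f by (simp add: C1_on_def open_Times)
  have 1: "C1_on (prod_scale s s') s1 (fst -` U) (\<lambda>z. f (fst z))"
    "fst z \<in> U \<Longrightarrow> differential (prod_scale s s') s1 (fst -` U) (\<lambda>z. f (fst z)) z v =
      differential s s1 U f (fst z) (fst v)" for z v
    by (rule C1_on_affine[OF m2 m(1,3) f(1)];
        auto intro!: continuous_intros simp: prod_scale_def)+
  have 2: "C1_on (prod_scale s s') s1' (snd -` U') (\<lambda>z. f' (snd z))"
    "snd z \<in> U' \<Longrightarrow> differential (prod_scale s s') s1' (snd -` U') (\<lambda>z. f' (snd z)) z v =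
      differential s' s1' U' f' (snd z) (snd v)" for z v
    by (rule C1_on_affine[OF m2 m(2,4) f(2)];
        auto intro!: continuous_intros simp: prod_scale_def)+
  have 3: "C1_on (prod_scale s s') s1 (U \<times> U') (\<lambda>z. f (fst z))"
    "C1_on (prod_scale s s') s1' (U \<times> U') (\<lambda>z. f' (snd z))"
    by (auto intro: C1_on_subset[OF 1(1) o] C1_on_subset[OF 2(1) o])
  note pair = C1_on_Pair[OF m2 m(3,4) 3]
  have eq: "map_prod f f' = (\<lambda>z. (f (fst z), f' (snd z)))" by auto
  show "C1_on (prod_scale s s') (prod_scale s1 s1') (U \<times> U') (map_prod f f')"
    unfolding eq by (rule pair(1))
  assume x: "x \<in> U" "x' \<in> U'"
  have "differential (prod_scale s s') s1 (U \<times> U') (\<lambda>z. f (fst z)) (x, x') (v, v')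
    = differential s s1 U f x v"
    using differential_local[OF m2 m(3) 3(1) 1(1), of "(x, x')" "(v, v')"] 1(2)[of "(x, x')"
      "(v, v')"] x by simp
  moreover have "differential (prod_scale s s') s1' (U \<times> U') (\<lambda>z. f' (snd z)) (x, x') (v, v')
    = differential s' s1' U' f' x' v'"
    using differential_local[OF m2 m(4) 3(2) 2(1), of "(x, x')" "(v, v')"] 2(2)[of "(x, x')"
      "(v, v')"] x by simp
  ultimately show "differential (prod_scale s s') (prod_scale s1 s1') (U \<times> U') (map_prod f f') (x,
    x') (v, v') =
      (differential s s1 U f x v, differential s' s1' U' f' x' v')"
    unfolding eq using pair(2)[of "(x, x')" "(v, v')"] x by simp
qed

lemma chart_inv_chart: "inj_on (snd c) (fst c) \<Longrightarrow> p \<in> fst c \<Longrightarrow> chart_inv c (snd c p) = p"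
  by (simp add: chart_inv_def)

lemma chart_chart_inv: "x \<in> snd c ` fst c \<Longrightarrow> snd c (chart_inv c x) = x \<and> chart_inv c x \<in> fst c"
  by (simp add: chart_inv_def f_inv_into_f inv_into_into)

lemma chart_in_rep_dom: "inj_on (snd c) (fst c) \<Longrightarrow> p \<in> fst c \<Longrightarrow> snd c p \<in> rep_dom c d f \<longleftrightarrow> f p \<in> fst d"
  by (auto simp: rep_dom_def inj_on_def)

lemma rep_chart: "inj_on (snd c) (fst c) \<Longrightarrow> p \<in> fst c \<Longrightarrow> rep c d f (snd c p) = snd d (f p)"
  by (simp add: rep_def chart_inv_chart)

lemma rep_domE:
  assumes "x \<in> rep_dom c d f"
  obtains p where "p \<in> fst c" "f p \<in> fst d" "x = snd c p"
  using assms by (auto simp: rep_dom_def)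

text \<open>The differential at the point \<open>p\<close> of \<open>f\<close> as represented in
  the charts \<open>c\<close> and \<open>d\<close>. For \<open>f = id\<close> it transforms
  components of tangent vectors from \<open>c\<close> to \<open>d\<close>.\<close>

definition drep ::
  "('k::smooth_base_ring \<Rightarrow> 'v::{topological_ab_group_add,t2_space} \<Rightarrow> 'v) \<Rightarrow>
   ('k \<Rightarrow> 'w::{topological_ab_group_add,t2_space} \<Rightarrow> 'w) \<Rightarrow> ('m, 'v) chart \<Rightarrow> ('n, 'w) chart \<Rightarrow>
   ('m \<Rightarrow> 'n) \<Rightarrow> 'm \<Rightarrow> 'v \<Rightarrow> 'w" where
  "drep s s' c d f p v = differential s s' (rep_dom c d f) (rep c d f) (snd c p) v"

lemma drep_comp:
  assumes m: "topological_module s" "topological_module s'" "topological_module s''"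
    and inj: "inj_on (snd c) (fst c)" "inj_on (snd d) (fst d)"
    and C1: "C1_on s s' (rep_dom c d f) (rep c d f)" "C1_on s' s'' (rep_dom d e g) (rep d e g)"
      "C1_on s s'' (rep_dom c e k) (rep c e k)"
    and p: "p \<in> fst c" "f p \<in> fst d" "g (f p) \<in> fst e"
    and eq: "\<And>q. q \<in> fst c \<Longrightarrow> f q \<in> fst d \<Longrightarrow> k q = g (f q)"
  shows "drep s s'' c e k p v = drep s' s'' d e g (f p) (drep s s' c d f p v)"
proof -
  have x: "snd c p \<in> rep_dom c d f" "snd c p \<in> rep_dom c e k" "rep c d f (snd c p) \<in> rep_dom d e g"
    using p inj eq by (simp_all add: chart_in_rep_dom rep_chart)
  have "rep c e k y = rep d e g (rep c d f y)" if y: "y \<in> rep_dom c d f" for y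
    using y inj eq by (auto elim!: rep_domE simp: rep_chart)
  then show ?thesis
    unfolding drep_def using differential_chain[OF m C1 x(1,3,2)] p inj by (simp add: rep_chart)
qed

section \<open>Manifolds of class \<open>C\<^sup>1\<close> and \<open>C\<^sup>2\<close>\<close>

text \<open>The two regularity classes that the construction of \<open>TTG\<close> passes
  through: the tangent bundle of a \<open>C\<^sup>2\<close> atlas is a \<open>C\<^sup>1\<close>
  atlas, and a \<open>C\<^sup>1\<close> atlas suffices to form tangent vectors.\<close>

definition C1_atlas ::
  "('k::smooth_base_ring \<Rightarrow> 'v::{topological_ab_group_add,t2_space} \<Rightarrow> 'v) \<Rightarrow> ('m, 'v) atlas \<Rightarrow> bool" where
  "C1_atlas s A \<longleftrightarrow> topological_module s \<and>
     (\<forall>c\<in>A. inj_on (snd c) (fst c) \<and> open (snd c ` fst c)) \<and>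
     (\<forall>c\<in>A. \<forall>d\<in>A. C1_on s s (rep_dom c d id) (rep c d id))"

definition C2_atlas ::
  "('k::smooth_base_ring \<Rightarrow> 'v::{topological_ab_group_add,t2_space} \<Rightarrow> 'v) \<Rightarrow> ('m, 'v) atlas \<Rightarrow> bool" where
  "C2_atlas s A \<longleftrightarrow> topological_module s \<and>
     (\<forall>c\<in>A. inj_on (snd c) (fst c) \<and> open (snd c ` fst c)) \<and>
     (\<forall>c\<in>A. \<forall>d\<in>A. C2_on s s (rep_dom c d id) (rep c d id))"

definition C1_map ::
  "('k::smooth_base_ring \<Rightarrow> 'v::{topological_ab_group_add,t2_space} \<Rightarrow> 'v) \<Rightarrow> ('m, 'v) atlas \<Rightarrow>
   ('k \<Rightarrow> 'w::{topological_ab_group_add,t2_space} \<Rightarrow> 'w) \<Rightarrow> ('n, 'w) atlas \<Rightarrow> ('m \<Rightarrow> 'n) \<Rightarrow> bool" where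
  "C1_map s A s' B f \<longleftrightarrow> f ` points A \<subseteq> points B \<and>
     (\<forall>c\<in>A. \<forall>d\<in>B. C1_on s s' (rep_dom c d f) (rep c d f))"

definition C2_map ::
  "('k::smooth_base_ring \<Rightarrow> 'v::{topological_ab_group_add,t2_space} \<Rightarrow> 'v) \<Rightarrow> ('m, 'v) atlas \<Rightarrow>
   ('k \<Rightarrow> 'w::{topological_ab_group_add,t2_space} \<Rightarrow> 'w) \<Rightarrow> ('n, 'w) atlas \<Rightarrow> ('m \<Rightarrow> 'n) \<Rightarrow> bool" where
  "C2_map s A s' B f \<longleftrightarrow> f ` points A \<subseteq> points B \<and>
     (\<forall>c\<in>A. \<forall>d\<in>B. C2_on s s' (rep_dom c d f) (rep c d f))"

lemma C2_atlas_imp_C1_atlas: "C2_atlas s A \<Longrightarrow> C1_atlas s A"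
  by (simp add: C1_atlas_def C2_atlas_def C2_on_imp_C1_on)

lemma C2_map_imp_C1_map: "C2_map s A s' B f \<Longrightarrow> C1_map s A s' B f"
  by (simp add: C1_map_def C2_map_def C2_on_imp_C1_on)

lemma C1_atlasD:
  assumes "C1_atlas s A"
  shows "topological_module s" "c \<in> A \<Longrightarrow> inj_on (snd c) (fst c)" "c \<in> A \<Longrightarrow> open (snd c ` fst c)"
    "c \<in> A \<Longrightarrow> d \<in> A \<Longrightarrow> C1_on s s (rep_dom c d id) (rep c d id)"
  using assms by (auto simp: C1_atlas_def)

lemma C1_mapD: "C1_map s A s' B f \<Longrightarrow> c \<in> A \<Longrightarrow> d \<in> B \<Longrightarrow> C1_on s s' (rep_dom c d f) (rep c d f)"
  by (simp add: C1_map_def)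

text \<open>A change from a chart to itself is the identity on the open chart image.\<close>

lemma drep_id_self:
  assumes A: "C1_atlas s A" "c \<in> A" "p \<in> fst c"
  shows "drep s s c c id p v = v"
  unfolding drep_def
proof (rule differential_eq_linear)
  show "snd c p \<in> rep_dom c c id" using A by (simp add: chart_in_rep_dom C1_atlasD)
  show "rep c c id (snd c p + s t v) = rep c c id (snd c p) + s t v"
    if "snd c p + s t v \<in> rep_dom c c id" for t
    using that A C1_atlasD(2)[OF A(1,2)] by (auto elim!: rep_domE simp: rep_chart)
qed (use A in \<open>simp_all add: C1_atlasD\<close>)

lemma drep_comp_maps:
  assumes A: "C1_atlas s A" "C1_atlas s' B" "C1_atlas s'' C"
    and f: "C1_map s A s' B f" and g: "C1_map s' B s'' C g" and k: "C1_map s A s'' C k"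
    and c: "c \<in> A" "d \<in> B" "e \<in> C"
    and p: "p \<in> fst c" "f p \<in> fst d" "g (f p) \<in> fst e"
    and eq: "\<And>q. q \<in> points A \<Longrightarrow> k q = g (f q)"
  shows "drep s s'' c e k p v = drep s' s'' d e g (f p) (drep s s' c d f p v)"
  by (rule drep_comp[OF C1_atlasD(1)[OF A(1)] C1_atlasD(1)[OF A(2)] C1_atlasD(1)[OF A(3)]
        C1_atlasD(2)[OF A(1) c(1)] C1_atlasD(2)[OF A(2) c(2)] C1_mapD[OF f c(1,2)] C1_mapD[OF g c(2,3)]
        C1_mapD[OF k c(1,3)] p])
    (use eq c in \<open>auto simp: points_def\<close>)

lemma C1_map_id: "C1_atlas s A \<Longrightarrow> C1_map s A s A id"
  by (simp add: C1_map_def C1_atlas_def)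

section \<open>Tangent vectors\<close>

lemma tangent_vector_drep:
  "tangent_vector s A c p v = (p, {(d, drep s s c d id p v) |d. d \<in> A \<and> p \<in> fst d})"
  by (simp add: tangent_vector_def drep_def)

lemma fst_tangent_vector [simp]: "fst (tangent_vector s A c p v) = p"
  by (simp add: tangent_vector_def)

lemma mem_tangent_vector:
  "(d, w) \<in> snd (tangent_vector s A c p v) \<longleftrightarrow> d \<in> A \<and> p \<in> fst d \<and> w = drep s s c d id p v"
  by (auto simp: tangent_vector_drep simp del: split_paired_Ex)

lemma component_tangent_vector:
  "d \<in> A \<Longrightarrow> p \<in> fst d \<Longrightarrow> component d (tangent_vector s A c p v) = drep s s c d id p v"
  by (simp add: component_def mem_tangent_vector)

lemma component_tangent_vector_self:
  "C1_atlas s A \<Longrightarrow> c \<in> A \<Longrightarrow> p \<in> fst c \<Longrightarrow> component c (tangent_vector s A c p v) = v"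
  by (simp add: component_tangent_vector drep_id_self)

text \<open>The cocycle property of the chart changes: both sides have the same component in
  every third chart.\<close>

lemma tangent_vector_change_chart:
  assumes A: "C1_atlas s A" "c \<in> A" "d \<in> A" "p \<in> fst c" "p \<in> fst d"
  shows "tangent_vector s A d p (drep s s c d id p v) = tangent_vector s A c p v"
proof -
  note i = C1_map_id[OF A(1)]
  have "drep s s d e id p (drep s s c d id p v) = drep s s c e id p v" if "e \<in> A" "p \<in> fst e" for e
    using drep_comp_maps[OF A(1,1,1) i i i A(2,3) that(1) A(4), of v] A(5) that(2) by simp
  then show ?thesis unfolding tangent_vector_drep by auto
qed

lemma zero_vector_eq:
  assumes A: "C1_atlas s A" "c \<in> A" "p \<in> fst c"
  shows "zero_vector A p = tangent_vector s A c p 0"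
proof -
  have "drep s s c d id p 0 = 0" if "d \<in> A" "p \<in> fst d" for d
    unfolding drep_def using that A by (auto intro!: differential_0 simp: C1_atlasD chart_in_rep_dom)
  then show ?thesis unfolding tangent_vector_drep zero_vector_def by auto
qed

text \<open>A tangent map is defined by all pairs of charts at once; the chain rule says that
  these pairs agree, so that one pair of charts is enough to compute it.\<close>

lemma tangent_map_tangent_vector:
  assumes A: "C1_atlas s A" "C1_atlas s' B" and f: "C1_map s A s' B f"
    and c: "c \<in> A" "d \<in> B" and p: "p \<in> fst c" "f p \<in> fst d"
  shows "tangent_map s s' B f (tangent_vector s A c p v)
    = tangent_vector s' B d (f p) (drep s s' c d f p v)"
proof -
  have 1: "drep s s' c' e f p (drep s s c c' id p v) = drep s s' c e f p v"
    if "c' \<in> A" "p \<in> fst c'" "e \<in> B" "f p \<in> fst e" for c' e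
    using drep_comp_maps[OF A(1,1,2) C1_map_id[OF A(1)] f f c(1) that(1,3) p(1), of v] that by simp
  have 2: "drep s' s' d e id (f p) (drep s s' c d f p v) = drep s s' c e f p v"
    if "e \<in> B" "f p \<in> fst e" for e
    using drep_comp_maps[OF A(1,2,2) f C1_map_id[OF A(2)] f c that(1) p, of v] that by simp
  have "{(e, drep s s' c' e f p w) |c' w e. (c', w) \<in> snd (tangent_vector s A c p v) \<and> e \<in> B
    \<and> f p \<in> fst e} =
      snd (tangent_vector s' B d (f p) (drep s s' c d f p v))" (is "?L = ?R")
  proof (intro equalityI subsetI)
    fix z assume "z \<in> ?L"
    then obtain c' e where *: "c' \<in> A" "p \<in> fst c'" "e \<in> B" "f p \<in> fst e"
      "z = (e, drep s s' c' e f p (drep s s c c' id p v))"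
      unfolding mem_tangent_vector by blast
    then show "z \<in> ?R" by (simp add: mem_tangent_vector 1 2)
  next
    fix z assume "z \<in> ?R"
    then obtain e where *: "e \<in> B" "f p \<in> fst e" "z = (e, drep s s' c e f p (drep s s c c id p v))"
      using 1[OF c(1) p(1)] 2 by (cases z) (simp add: mem_tangent_vector)
    then show "z \<in> ?L" using c(1) p(1) unfolding mem_tangent_vector by blast
  qed
  then show ?thesis
    by (simp add: tangent_map_def drep_def prod_eq_iff)
qed

section \<open>The tangent bundle\<close>

lemma in_tangent_chart:
  assumes A: "C1_atlas s A" "c \<in> A" "d \<in> A" "p \<in> fst c"
  shows "tangent_vector s A c p v \<in> fst (tangent_chart s A d) \<longleftrightarrow> p \<in> fst d"
proof
  assume "p \<in> fst d"
  from this show "tangent_vector s A c p v \<in> fst (tangent_chart s A d)"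
    unfolding tangent_vector_change_chart[OF A \<open>p \<in> fst d\<close>, of v, symmetric]
    by (auto simp: tangent_chart_def)
next
  assume "tangent_vector s A c p v \<in> fst (tangent_chart s A d)"
  then obtain q w where "tangent_vector s A c p v = tangent_vector s A d q w" "q \<in> fst d"
    by (auto simp: tangent_chart_def)
  then show "p \<in> fst d" by (metis fst_tangent_vector)
qed

lemma in_tangent_chartE:
  assumes "\<xi> \<in> fst (tangent_chart s A c)"
  obtains p v where "p \<in> fst c" "\<xi> = tangent_vector s A c p v"
  using assms by (auto simp: tangent_chart_def)

lemma tangent_chart_tangent_vector:
  assumes A: "C1_atlas s A" "c \<in> A" "d \<in> A" "p \<in> fst c" "p \<in> fst d"
  shows "snd (tangent_chart s A d) (tangent_vector s A c p v) = (snd d p, drep s s c d id p v)"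
  using A by (simp add: tangent_chart_def component_tangent_vector)

lemma tangent_chart_self:
  assumes A: "C1_atlas s A" "c \<in> A" "p \<in> fst c"
  shows "snd (tangent_chart s A c) (tangent_vector s A c p v) = (snd c p, v)"
  using A by (simp add: tangent_chart_tangent_vector drep_id_self)

lemma tangent_chart_image:
  assumes A: "C1_atlas s A" "c \<in> A"
  shows "snd (tangent_chart s A c) ` fst (tangent_chart s A c) = (snd c ` fst c) \<times> UNIV"
proof -
  have "(snd c p, v) \<in> snd (tangent_chart s A c) ` fst (tangent_chart s A c)" if "p \<in> fst c" for p v
    using tangent_chart_self[OF A that, of v] in_tangent_chart[OF A A(2) that, of v] that by force
  then show ?thesis using tangent_chart_self[OF A] by (fastforce elim!: in_tangent_chartE)
qed

lemma inj_on_tangent_chart: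
  assumes A: "C1_atlas s A" "c \<in> A"
  shows "inj_on (snd (tangent_chart s A c)) (fst (tangent_chart s A c))"
proof (rule inj_onI)
  fix \<xi> \<eta> assume \<xi>: "\<xi> \<in> fst (tangent_chart s A c)" and \<eta>: "\<eta> \<in> fst (tangent_chart s A c)"
    and eq: "snd (tangent_chart s A c) \<xi> = snd (tangent_chart s A c) \<eta>"
  obtain p v where 1: "p \<in> fst c" "\<xi> = tangent_vector s A c p v" using \<xi> by (rule in_tangent_chartE)
  obtain q w where 2: "q \<in> fst c" "\<eta> = tangent_vector s A c q w" using \<eta> by (rule in_tangent_chartE)
  have "snd c p = snd c q" "v = w" using eq 1 2 tangent_chart_self[OF A] by auto
  then show "\<xi> = \<eta>" using 1 2 C1_atlasD(2)[OF A] by (auto simp: inj_on_def)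
qed

lemma chart_inv_tangent_chart:
  assumes A: "C1_atlas s A" "c \<in> A" "p \<in> fst c"
  shows "chart_inv (tangent_chart s A c) (snd c p, v) = tangent_vector s A c p v"
  using chart_inv_chart[OF inj_on_tangent_chart[OF A(1,2)], of "tangent_vector s A c p v"]
    in_tangent_chart[OF A(1,2,2,3)] tangent_chart_self[OF A] A(3) by simp

lemma points_tangent_bundleE:
  assumes "\<xi> \<in> points (tangent_bundle s A)"
  obtains c p v where "c \<in> A" "p \<in> fst c" "\<xi> = tangent_vector s A c p v"
  using assms by (auto simp: points_def tangent_bundle_def tangent_chart_def)

lemma points_tangent_bundle_chart:
  assumes A: "C1_atlas s A" "c \<in> A" and \<xi>: "\<xi> \<in> points (tangent_bundle s A)" "fst \<xi> \<in> fst c"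
  shows "\<xi> = tangent_vector s A c (fst \<xi>) (component c \<xi>)"
proof -
  obtain d p v where *: "d \<in> A" "p \<in> fst d" "\<xi> = tangent_vector s A d p v"
    using \<xi>(1) by (rule points_tangent_bundleE)
  then show ?thesis
    using tangent_vector_change_chart[OF A(1) *(1) A(2) *(2)] \<xi>(2) A
      by (simp add: component_tangent_vector)
qed

lemma tangent_vector_in_points:
  "c \<in> A \<Longrightarrow> p \<in> fst c \<Longrightarrow> tangent_vector s A c p v \<in> points (tangent_bundle s A)"
  by (auto simp: points_def tangent_bundle_def tangent_chart_def)

text \<open>In the charts \<open>Tc\<close> and \<open>Td\<close> the change of charts is the
  tangent map of the change from \<open>c\<close> to \<open>d\<close>.\<close>

lemma C1_atlas_tangent_bundle:
  fixes s :: "'k::smooth_base_ring \<Rightarrow> 'v::{topological_ab_group_add,t2_space} \<Rightarrow> 'v"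
  assumes A: "C2_atlas s A"
  shows "C1_atlas (prod_scale s s) (tangent_bundle s A)"
  unfolding C1_atlas_def
proof (intro conjI ballI)
  note A1 = C2_atlas_imp_C1_atlas[OF A]
  note m = C1_atlasD(1)[OF A1]
  show "topological_module (prod_scale s s)" by (intro topological_module_prod_scale m)
  fix C assume "C \<in> tangent_bundle s A"
  then obtain c where c: "c \<in> A" "C = tangent_chart s A c" by (auto simp: tangent_bundle_def)
  show "inj_on (snd C) (fst C)" using inj_on_tangent_chart[OF A1] c by simp
  show "open (snd C ` fst C)"
    using tangent_chart_image[OF A1] c C1_atlasD(3)[OF A1] by (simp add: open_Times)
  fix D assume "D \<in> tangent_bundle s A"
  then obtain d where d: "d \<in> A" "D = tangent_chart s A d" by (auto simp: tangent_bundle_def)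
  note inj = C1_atlasD(2)[OF A1 c(1)]
  have dom: "rep_dom C D id = rep_dom c d id \<times> UNIV"
  proof (intro equalityI subsetI)
    fix z assume "z \<in> rep_dom C D id"
    then obtain \<xi> where \<xi>: "\<xi> \<in> fst C" "\<xi> \<in> fst D" "z = snd C \<xi>" by (auto elim!: rep_domE)
    then obtain p v where "p \<in> fst c" "\<xi> = tangent_vector s A c p v"
      using c by (auto elim: in_tangent_chartE)
    then show "z \<in> rep_dom c d id \<times> UNIV"
      using \<xi> c d in_tangent_chart[OF A1 c(1) d(1)] tangent_chart_self[OF A1 c(1)]
      by (auto simp: chart_in_rep_dom[OF inj])
  next
    fix z :: "'v \<times> 'v" assume "z \<in> rep_dom c d id \<times> UNIV"
    then obtain p v where z: "p \<in> fst c" "p \<in> fst d" "z = (snd c p, v)" by (auto elim!: rep_domE)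
    then have "tangent_vector s A c p v \<in> fst C \<inter> fst D"
      using in_tangent_chart[OF A1 c(1)] c d by auto
    then have "snd C (tangent_vector s A c p v) \<in> rep_dom C D id" by (auto simp: rep_dom_def)
    then show "z \<in> rep_dom C D id" using tangent_chart_self[OF A1 c(1)] z c by simp
  qed
  have rep: "rep C D id z = (rep c d id (fst z), differential s s (rep_dom c d id) (rep c d id) (fst
    z) (snd z))"
    if "z \<in> rep_dom c d id \<times> UNIV" for z :: "'v \<times> 'v"
  proof -
    obtain p v where z: "p \<in> fst c" "p \<in> fst d" "z = (snd c p, v)" using \<open>z \<in> _\<close> by (auto elim!: rep_domE)
    show ?thesis
      using z c d chart_inv_tangent_chart[OF A1 c(1) z(1)] tangent_chart_tangent_vector[OF A1 c(1)
        d(1) z(1,2)] inj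
      by (simp add: rep_def chart_inv_chart drep_def)
  qed
  have "C2_on s s (rep_dom c d id) (rep c d id)" using A c d by (simp add: C2_atlas_def)
  from C1_on_tangent(1)[OF m m this] show "C1_on (prod_scale s s) (prod_scale s s) (rep_dom C D id)
    (rep C D id)"
    unfolding dom by (rule C1_on_cong) (simp add: rep)
qed

section \<open>Products\<close>

lemma prod_chart_simps [simp]:
  "fst (prod_chart c d) = fst c \<times> fst d" "snd (prod_chart c d) (p, q) = (snd c p, snd d q)"
  by (simp_all add: prod_chart_def)

lemma inj_on_prod_chart:
  "inj_on (snd c) (fst c) \<Longrightarrow> inj_on (snd d) (fst d) \<Longrightarrow> inj_on (snd (prod_chart c d)) (fst (prod_chart c d))"
  by (simp add: prod_chart_def map_prod_inj_on)

lemma prod_chart_in_prod_atlas: "c \<in> A \<Longrightarrow> d \<in> B \<Longrightarrow> prod_chart c d \<in> prod_atlas A B"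
  unfolding prod_atlas_def by blast

lemma prod_atlasE:
  assumes "C \<in> prod_atlas A B"
  obtains c d where "c \<in> A" "d \<in> B" "C = prod_chart c d"
  using assms unfolding prod_atlas_def by blast

lemma points_prod_atlas: "points (prod_atlas A B) = points A \<times> points B"
  by (force simp: points_def prod_atlas_def)

lemma rep_prod_chart:
  assumes inj: "inj_on (snd c) (fst c)" "inj_on (snd d) (fst d)"
  shows "rep_dom (prod_chart c d) (prod_chart c' d') id = rep_dom c c' id \<times> rep_dom d d' id"
    and "z \<in> rep_dom c c' id \<times> rep_dom d d' id \<Longrightarrow>
      rep (prod_chart c d) (prod_chart c' d') id z = map_prod (rep c c' id) (rep d d' id) z"
proof -
  show "rep_dom (prod_chart c d) (prod_chart c' d') id = rep_dom c c' id \<times> rep_dom d d' id"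
    by (force simp: rep_dom_def)
  assume "z \<in> rep_dom c c' id \<times> rep_dom d d' id"
  then obtain p q where "p \<in> fst c" "q \<in> fst d" "z = (snd c p, snd d q)" by (auto elim!: rep_domE)
  then show "rep (prod_chart c d) (prod_chart c' d') id z = map_prod (rep c c' id) (rep d d' id) z"
    using inj by (simp add: rep_chart rep_chart[OF inj_on_prod_chart[OF inj], of "(p, q)", simplified])
qed

lemma C1_atlas_prod:
  assumes A: "C1_atlas s A" and B: "C1_atlas s' B"
  shows "C1_atlas (prod_scale s s') (prod_atlas A B)"
    and "c \<in> A \<Longrightarrow> c' \<in> A \<Longrightarrow> d \<in> B \<Longrightarrow> d' \<in> B \<Longrightarrow> p \<in> fst c \<Longrightarrow> p \<in> fst c' \<Longrightarrow> q \<in> fst d \<Longrightarrow> q \<in> fst d' \<Longrightarrow>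
      drep (prod_scale s s') (prod_scale s s') (prod_chart c d) (prod_chart c' d') id (p, q) (v, w) =
      (drep s s c c' id p v, drep s' s' d d' id q w)"
proof -
  note m = C1_atlasD(1)[OF A] C1_atlasD(1)[OF B]
  have m2: "topological_module (prod_scale s s')" by (intro topological_module_prod_scale m)
  note C1_prod = C1_on_map_prod[OF m m C1_atlasD(4)[OF A] C1_atlasD(4)[OF B]]
  have rep: "C1_on (prod_scale s s') (prod_scale s s') (rep_dom (prod_chart c d) (prod_chart c' d') id)
      (rep (prod_chart c d) (prod_chart c' d') id)"
    if c: "c \<in> A" "c' \<in> A" "d \<in> B" "d' \<in> B" for c c' d d'
    unfolding rep_prod_chart(1)[OF C1_atlasD(2)[OF A c(1)] C1_atlasD(2)[OF B c(3)]]
    by (rule C1_on_cong[OF C1_prod(1)[OF c]])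
      (simp add: rep_prod_chart(2)[OF C1_atlasD(2)[OF A c(1)] C1_atlasD(2)[OF B c(3)]])
  show "C1_atlas (prod_scale s s') (prod_atlas A B)"
    unfolding C1_atlas_def
  proof (intro conjI ballI)
    show "topological_module (prod_scale s s')" by (rule m2)
    fix C assume "C \<in> prod_atlas A B"
    then obtain c d where c: "c \<in> A" "d \<in> B" "C = prod_chart c d" by (rule prod_atlasE)
    show "inj_on (snd C) (fst C)"
      using inj_on_prod_chart[OF C1_atlasD(2)[OF A c(1)] C1_atlasD(2)[OF B c(2)]] c(3) by simp
    have "snd C ` fst C = (snd c ` fst c) \<times> (snd d ` fst d)"
      using c(3) by (force simp: prod_chart_def)
    then show "open (snd C ` fst C)"
      using C1_atlasD(3)[OF A c(1)] C1_atlasD(3)[OF B c(2)] by (simp add: open_Times)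
    fix D assume "D \<in> prod_atlas A B"
    then obtain c' d' where "c' \<in> A" "d' \<in> B" "D = prod_chart c' d'" by (rule prod_atlasE)
    then show "C1_on (prod_scale s s') (prod_scale s s') (rep_dom C D id) (rep C D id)"
      using rep c by simp
  qed
  assume c: "c \<in> A" "c' \<in> A" "d \<in> B" "d' \<in> B" and p: "p \<in> fst c" "p \<in> fst c'" "q \<in> fst d" "q \<in> fst d'"
  note inj = C1_atlasD(2)[OF A c(1)] C1_atlasD(2)[OF B c(3)]
  have mem: "snd c p \<in> rep_dom c c' id" "snd d q \<in> rep_dom d d' id"
    using p inj by (simp_all add: chart_in_rep_dom)
  show "drep (prod_scale s s') (prod_scale s s') (prod_chart c d) (prod_chart c' d') id (p, q) (v, w) =
      (drep s s c c' id p v, drep s' s' d d' id q w)"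
    unfolding drep_def prod_chart_simps C1_prod(2)[OF c mem, symmetric]
    by (rule differential_local[OF m2 m2 rep[OF c] C1_prod(1)[OF c]])
      (use mem in \<open>simp_all add: rep_prod_chart[OF inj]\<close>)
qed

text \<open>Componentwise pairing is the identification of \<open>TM \<times> TN\<close> with
  \<open>T(M \<times> N)\<close>, since chart changes of the product differentiate factorwise.\<close>

lemma tangent_pair_tangent_vector:
  assumes A: "C1_atlas s A" and B: "C1_atlas s' B"
    and c: "c \<in> A" "d \<in> B" "p \<in> fst c" "q \<in> fst d"
  shows "tangent_pair (tangent_vector s A c p v) (tangent_vector s' B d q w) =
    tangent_vector (prod_scale s s') (prod_atlas A B) (prod_chart c d) (p, q) (v, w)"
proof -
  note d = C1_atlas_prod(2)[OF A B c(1) _ c(2) _ c(3) _ c(4)]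
  have "{(prod_chart c' d', v', w') |c' v' d' w'. (c', v') \<in> snd (tangent_vector s A c p v) \<and>
       (d', w') \<in> snd (tangent_vector s' B d q w)} =
    snd (tangent_vector (prod_scale s s') (prod_atlas A B) (prod_chart c d) (p, q) (v, w))" (is "?L = ?R")
  proof (intro equalityI subsetI)
    fix z assume "z \<in> ?L"
    then obtain c' d' where *: "c' \<in> A" "p \<in> fst c'" "d' \<in> B" "q \<in> fst d'"
      "z = (prod_chart c' d', drep s s c c' id p v, drep s' s' d d' id q w)"
      unfolding mem_tangent_vector by blast
    then have "prod_chart c' d' \<in> prod_atlas A B" by (simp add: prod_chart_in_prod_atlas)
    with * show "z \<in> ?R" by (simp add: mem_tangent_vector d)
  next
    fix z assume "z \<in> ?R"
    moreover obtain D u where z: "z = (D, u)" by (cases z)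
    ultimately have D: "D \<in> prod_atlas A B" "(p, q) \<in> fst D"
      "u = drep (prod_scale s s') (prod_scale s s') (prod_chart c d) D id (p, q) (v, w)"
      by (simp_all add: mem_tangent_vector)
    then obtain c' d' where *: "c' \<in> A" "p \<in> fst c'" "d' \<in> B" "q \<in> fst d'" "D = prod_chart c' d'"
      by (auto elim!: prod_atlasE)
    then have "u = (drep s s c c' id p v, drep s' s' d d' id q w)" using d D(3) by simp
    with * show "z \<in> ?L" unfolding z mem_tangent_vector by blast
  qed
  then show ?thesis
    by (simp add: tangent_pair_def prod_eq_iff)
qed

section \<open>The tangent map of a map on a product\<close>

text \<open>The coordinates of \<open>TM \<times> TN\<close> are \<open>((x, v), (y,
  w))\<close>, those of \<open>T(M \<times> N)\<close> are \<open>((x, y), (v, w))\<close>.\<close>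

definition swap_middle :: "('a \<times> 'b) \<times> ('c \<times> 'd) \<Rightarrow> ('a \<times> 'c) \<times> ('b \<times> 'd)" where
  "swap_middle z = ((fst (fst z), fst (snd z)), (snd (fst z), snd (snd z)))"

lemma swap_middle_simp [simp]: "swap_middle ((a, b), (c, d)) = ((a, c), (b, d))"
  by (simp add: swap_middle_def)

lemma continuous_on_swap_middle: "continuous_on UNIV swap_middle"
  unfolding swap_middle_def by (intro continuous_intros)

lemma tangent_map_pair:
  assumes A: "C1_atlas s A" "C1_atlas s' B" "C1_atlas s'' C"
    and f: "C1_map (prod_scale s s') (prod_atlas A B) s'' C f"
    and c: "c \<in> A" "d \<in> B" "e \<in> C" and p: "p \<in> fst c" "q \<in> fst d" "f (p, q) \<in> fst e"
  shows "tangent_map (prod_scale s s') s'' C f (tangent_pair (tangent_vector s A c p v)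
    (tangent_vector s' B d q w)) =
    tangent_vector s'' C e (f (p, q)) (drep (prod_scale s s') s'' (prod_chart c d) e f (p, q) (v, w))"
  unfolding tangent_pair_tangent_vector[OF A(1,2) c(1,2) p(1,2)]
  by (rule tangent_map_tangent_vector[OF C1_atlas_prod(1)[OF A(1,2)] A(3) f])
    (use c p in \<open>simp_all add: prod_chart_in_prod_atlas\<close>)

text \<open>In charts, the tangent map of \<open>f\<close> on \<open>TM \<times> TN\<close> is
  the tangent map of the representative of \<open>f\<close>, after the rearrangement of
  coordinates.\<close>

lemma rep_tangent_map_pair:
  fixes s :: "'k::smooth_base_ring \<Rightarrow> 'v::{topological_ab_group_add,t2_space} \<Rightarrow> 'v"
    and s' :: "'k \<Rightarrow> 'w::{topological_ab_group_add,t2_space} \<Rightarrow> 'w"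
    and s'' :: "'k \<Rightarrow> 'u::{topological_ab_group_add,t2_space} \<Rightarrow> 'u"
    and A :: "('m, 'v) atlas" and B :: "('n, 'w) atlas" and C :: "('o, 'u) atlas"
  defines "F f \<equiv> (\<lambda>(\<xi>, \<eta>). tangent_map (prod_scale s s') s'' C f (tangent_pair \<xi> \<eta>))"
  assumes A: "C1_atlas s A" "C1_atlas s' B" "C1_atlas s'' C"
    and f: "C1_map (prod_scale s s') (prod_atlas A B) s'' C f"
    and c: "c \<in> A" "d \<in> B" "e \<in> C"
  shows "rep_dom (prod_chart (tangent_chart s A c) (tangent_chart s' B d)) (tangent_chart s'' C e) (F f) =
      swap_middle -` (rep_dom (prod_chart c d) e f \<times> UNIV)" (is "?D = ?R")
    and "z \<in> swap_middle -` (rep_dom (prod_chart c d) e f \<times> UNIV) \<Longrightarrow>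
      rep (prod_chart (tangent_chart s A c) (tangent_chart s' B d)) (tangent_chart s'' C e) (F f) z =
      (rep (prod_chart c d) e f (fst (swap_middle z)),
       differential (prod_scale s s') s'' (rep_dom (prod_chart c d) e f) (rep (prod_chart c d) e f)
         (fst (swap_middle z)) (snd (swap_middle z)))"
proof -
  note inj = C1_atlasD(2)[OF A(1) c(1)] C1_atlasD(2)[OF A(2) c(2)]
  note injT = inj_on_prod_chart[OF inj_on_tangent_chart[OF A(1) c(1)] inj_on_tangent_chart[OF A(2) c(2)]]
  note self = tangent_chart_self[OF A(1) c(1)] tangent_chart_self[OF A(2) c(2)]
  note inT = in_tangent_chart[OF A(1) c(1,1)] in_tangent_chart[OF A(2) c(2,2)]
  have mem: "F f (tangent_vector s A c p v, tangent_vector s' B d q w) \<in> fst (tangent_chart s'' C e) \<longleftrightarrow>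
      f (p, q) \<in> fst e" if p: "p \<in> fst c" "q \<in> fst d" for p q v w
  proof -
    have "(p, q) \<in> points (prod_atlas A B)" unfolding points_prod_atlas using c p
      by (auto simp: points_def)
    then obtain e' where e': "e' \<in> C" "f (p, q) \<in> fst e'" using f unfolding C1_map_def points_def by blast
    show ?thesis
      using tangent_map_pair[OF A f c(1,2) e'(1) p e'(2)] in_tangent_chart[OF A(3) e'(1) c(3) e'(2)]
      by (simp add: F_def)
  qed
  show eq: "?D = ?R"
  proof (intro equalityI subsetI)
    fix z assume "z \<in> ?D"
    then obtain \<xi> \<eta> where \<xi>: "\<xi> \<in> fst (tangent_chart s A c)" "\<eta> \<in> fst (tangent_chart s' B d)"
      "F f (\<xi>, \<eta>) \<in> fst (tangent_chart s'' C e)"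
      "z = (snd (tangent_chart s A c) \<xi>, snd (tangent_chart s' B d) \<eta>)"
      by (auto elim!: rep_domE)
    obtain p v where p: "p \<in> fst c" "\<xi> = tangent_vector s A c p v" using \<xi>(1) by (rule in_tangent_chartE)
    obtain q w where q: "q \<in> fst d" "\<eta> = tangent_vector s' B d q w" using \<xi>(2) by (rule in_tangent_chartE)
    have "f (p, q) \<in> fst e" using mem \<xi>(3) p q by simp
    then show "z \<in> ?R" using p q \<xi>(4) self
      by (simp add: chart_in_rep_dom[OF inj_on_prod_chart[OF inj], of "(p, q)", simplified])
  next
    fix z :: "('v \<times> 'v) \<times> ('w \<times> 'w)" assume "z \<in> ?R"
    then obtain p q v w where z: "p \<in> fst c" "q \<in> fst d" "f (p, q) \<in> fst e" "z
      = ((snd c p, v), (snd d q, w))"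
      by (cases z) (auto elim!: rep_domE)
    then show "z \<in> ?D"
      using chart_in_rep_dom[OF injT, of "(tangent_vector s A c p v, tangent_vector s' B d q w)"
          "tangent_chart s'' C e" "F f"] mem self inT by simp
  qed
  assume "z \<in> ?R"
  then obtain p q v w where z: "p \<in> fst c" "q \<in> fst d" "f (p, q) \<in> fst e" "z
    = ((snd c p, v), (snd d q, w))"
    by (cases z) (auto elim!: rep_domE)
  have "rep (prod_chart (tangent_chart s A c) (tangent_chart s' B d)) (tangent_chart s'' C e) (F f) z =
      snd (tangent_chart s'' C e) (F f (tangent_vector s A c p v, tangent_vector s' B d q w))"
    using rep_chart[OF injT, of "(tangent_vector s A c p v, tangent_vector s' B d q w)"
        "tangent_chart s'' C e" "F f"] self inT z by simp
  also have "\<dots> = snd (tangent_chart s'' C e) (tangent_vector s'' C e (f (p, q))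
      (drep (prod_scale s s') s'' (prod_chart c d) e f (p, q) (v, w)))"
    using tangent_map_pair[OF A f c z(1-3)] by (simp add: F_def)
  also have "\<dots> = (snd e (f (p, q)), drep (prod_scale s s') s'' (prod_chart c d) e f (p, q) (v, w))"
    by (rule tangent_chart_self[OF A(3) c(3) z(3)])
  finally show "rep (prod_chart (tangent_chart s A c) (tangent_chart s' B d)) (tangent_chart s'' C
    e) (F f) z =
      (rep (prod_chart c d) e f (fst (swap_middle z)),
       differential (prod_scale s s') s'' (rep_dom (prod_chart c d) e f) (rep (prod_chart c d) e f)
         (fst (swap_middle z)) (snd (swap_middle z)))"
    using z(1,2,4) by (simp add: drep_def rep_chart[OF inj_on_prod_chart[OF inj], of
      "(p, q)", simplified])
qed

text \<open>The regularity that allows the tangent functor to be applied to \<open>f\<close> a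
  second time, together with the resulting second tangent map. Both come from the representation
  by \<open>C1_on_tangent\<close> and the linear rearrangement.\<close>

lemma C1_map_tangent_map_pair:
  fixes s :: "'k::smooth_base_ring \<Rightarrow> 'v::{topological_ab_group_add,t2_space} \<Rightarrow> 'v"
    and s' :: "'k \<Rightarrow> 'w::{topological_ab_group_add,t2_space} \<Rightarrow> 'w"
    and s'' :: "'k \<Rightarrow> 'u::{topological_ab_group_add,t2_space} \<Rightarrow> 'u"
    and A :: "('m, 'v) atlas" and B :: "('n, 'w) atlas" and C :: "('o, 'u) atlas"
  defines "F f \<equiv> (\<lambda>(\<xi>, \<eta>). tangent_map (prod_scale s s') s'' C f (tangent_pair \<xi> \<eta>))"
  assumes A: "C1_atlas s A" "C1_atlas s' B" "C1_atlas s'' C"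
    and f: "C2_map (prod_scale s s') (prod_atlas A B) s'' C f"
  shows "C1_map (prod_scale (prod_scale s s) (prod_scale s' s'))
      (prod_atlas (tangent_bundle s A) (tangent_bundle s' B)) (prod_scale s'' s'') (tangent_bundle
        s'' C) (F f)"
    and "c \<in> A \<Longrightarrow> d \<in> B \<Longrightarrow> e \<in> C \<Longrightarrow> p \<in> fst c \<Longrightarrow> q \<in> fst d \<Longrightarrow> f (p, q) \<in> fst e \<Longrightarrow>
      drep (prod_scale (prod_scale s s) (prod_scale s' s')) (prod_scale s'' s'')
        (prod_chart (tangent_chart s A c) (tangent_chart s' B d)) (tangent_chart s'' C e) (F f)
        (tangent_vector s A c p v, tangent_vector s' B d q w) ((v', v''), (w', w'')) =
      (drep (prod_scale s s') s'' (prod_chart c d) e f (p, q) (v', w'),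
       second_differential (prod_scale s s') s'' (rep_dom (prod_chart c d) e f) (rep (prod_chart c d) e f)
         (snd c p, snd d q) (v, w) (v', w') +
       drep (prod_scale s s') s'' (prod_chart c d) e f (p, q) (v'', w''))"
proof -
  note f1 = C2_map_imp_C1_map[OF f]
  note m = C1_atlasD(1)[OF A(1)] C1_atlasD(1)[OF A(2)] C1_atlasD(1)[OF A(3)]
  have m2: "topological_module (prod_scale s s')" and mm:
    "topological_module (prod_scale (prod_scale s s') (prod_scale s s'))"
    "topological_module (prod_scale s'' s'')" "topological_module (prod_scale (prod_scale s s)
      (prod_scale s' s'))"
    by (intro topological_module_prod_scale m)+
  let ?U = "\<lambda>c d e. rep_dom (prod_chart c d) e f"
  let ?r = "\<lambda>c d e. rep (prod_chart c d) e f"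
  let ?T = "\<lambda>c d e z. (?r c d e (fst z), differential (prod_scale s s') s'' (?U c d e) (?r c d e)
    (fst z) (snd z))"
  let ?TD = "\<lambda>c d e. rep_dom (prod_chart (tangent_chart s A c) (tangent_chart s' B d))
    (tangent_chart s'' C e) (F f)"
  let ?Tr = "\<lambda>c d e. rep (prod_chart (tangent_chart s A c) (tangent_chart s' B d)) (tangent_chart
    s'' C e) (F f)"
  have C2: "C2_on (prod_scale s s') s'' (?U c d e) (?r c d e)" if "c \<in> A" "d \<in> B" "e \<in> C" for c d e
    using f that by (simp add: C2_map_def prod_chart_in_prod_atlas)
  note T = C1_on_tangent[OF m2 m(3) C2]
  have lin: "swap_middle (x + prod_scale (prod_scale s s) (prod_scale s' s') t v) =
      swap_middle x + prod_scale (prod_scale s s') (prod_scale s s') t (swap_middle v)" for x v t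
    by (cases x, cases v) (auto simp: swap_middle_def prod_scale_def)
  note aff = C1_on_affine[OF mm(3,1,2) T(1) continuous_on_swap_middle continuous_on_swap_middle lin]
  have C1: "C1_on (prod_scale (prod_scale s s) (prod_scale s' s')) (prod_scale s'' s'') (?TD c d e)
    (?Tr c d e)"
    if c: "c \<in> A" "d \<in> B" "e \<in> C" for c d e
    unfolding F_def rep_tangent_map_pair(1)[OF A f1 c]
    by (rule C1_on_cong[OF aff(1)[OF c]]) (simp add: rep_tangent_map_pair(2)[OF A f1 c])
  show "C1_map (prod_scale (prod_scale s s) (prod_scale s' s'))
      (prod_atlas (tangent_bundle s A) (tangent_bundle s' B)) (prod_scale s'' s'') (tangent_bundle
        s'' C) (F f)"
    unfolding C1_map_def
  proof (intro conjI ballI subsetI)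
    fix y assume "y \<in> F f ` points (prod_atlas (tangent_bundle s A) (tangent_bundle s' B))"
    then obtain \<xi> \<eta> where y: "y = F f (\<xi>, \<eta>)" "\<xi> \<in> points (tangent_bundle s A)"
      "\<eta> \<in> points (tangent_bundle s' B)"
      by (auto simp: points_prod_atlas)
    obtain c p v where c: "c \<in> A" "p \<in> fst c" "\<xi> = tangent_vector s A c p v"
      using y(2) by (rule points_tangent_bundleE)
    obtain d q w where d: "d \<in> B" "q \<in> fst d" "\<eta> = tangent_vector s' B d q w"
      using y(3) by (rule points_tangent_bundleE)
    have "(p, q) \<in> points (prod_atlas A B)" unfolding points_prod_atlas using c d
      by (auto simp: points_def)
    then obtain e where e: "e \<in> C" "f (p, q) \<in> fst e" using f unfolding C2_map_def points_def by blast
    show "y \<in> points (tangent_bundle s'' C)"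
      using tangent_map_pair[OF A f1 c(1) d(1) e(1) c(2) d(2) e(2)] tangent_vector_in_points[OF e]
        y(1) c(3) d(3)
      by (simp add: F_def)
  next
    fix D E assume "D \<in> prod_atlas (tangent_bundle s A) (tangent_bundle s' B)" "E \<in> tangent_bundle s'' C"
    then obtain c d e where "c \<in> A" "d \<in> B" "e \<in> C"
      "D = prod_chart (tangent_chart s A c) (tangent_chart s' B d)" "E = tangent_chart s'' C e"
      by (auto simp: tangent_bundle_def elim!: prod_atlasE)
    then show "C1_on (prod_scale (prod_scale s s) (prod_scale s' s')) (prod_scale s'' s'')
        (rep_dom D E (F f)) (rep D E (F f))"
      using C1 by simp
  qed
  assume c: "c \<in> A" "d \<in> B" "e \<in> C" and p: "p \<in> fst c" "q \<in> fst d" "f (p, q) \<in> fst e"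
  let ?z = "((snd c p, v), (snd d q, w))"
  have xy: "(snd c p, snd d q) \<in> ?U c d e"
    using chart_in_rep_dom[OF inj_on_prod_chart[OF C1_atlasD(2)[OF A(1) c(1)] C1_atlasD(2)[OF A(2) c(2)]],
        of "(p, q)" e f] p by simp
  have "differential (prod_scale (prod_scale s s) (prod_scale s' s')) (prod_scale s'' s'')
      (?TD c d e) (?Tr c d e) ?z ((v', v''), (w', w'')) =
    differential (prod_scale (prod_scale s s) (prod_scale s' s')) (prod_scale s'' s'')
      (swap_middle -` (?U c d e \<times> UNIV)) (\<lambda>z. ?T c d e (swap_middle z)) ?z ((v', v''), (w', w''))"
    by (rule differential_local[OF mm(3,2) C1[OF c] aff(1)[OF c]])
      (use xy in \<open>simp_all add: F_def rep_tangent_map_pair[OF A f1 c]\<close>)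
  also have "\<dots> = differential (prod_scale (prod_scale s s') (prod_scale s s')) (prod_scale s'' s'')
      (?U c d e \<times> UNIV) (?T c d e) (swap_middle ?z) (swap_middle ((v', v''), (w', w'')))"
    by (rule aff(2)[OF c]) (use xy in simp)
  also have "\<dots> = (drep (prod_scale s s') s'' (prod_chart c d) e f (p, q) (v', w'),
       second_differential (prod_scale s s') s'' (?U c d e) (?r c d e) (snd c p, snd d q) (v, w)
         (v', w') +
       drep (prod_scale s s') s'' (prod_chart c d) e f (p, q) (v'', w''))"
    using T(2)[OF c xy] by (simp add: drep_def)
  finally show "drep (prod_scale (prod_scale s s) (prod_scale s' s')) (prod_scale s'' s'')
        (prod_chart (tangent_chart s A c) (tangent_chart s' B d)) (tangent_chart s'' C e) (F f)
        (tangent_vector s A c p v, tangent_vector s' B d q w) ((v', v''), (w', w'')) =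
      (drep (prod_scale s s') s'' (prod_chart c d) e f (p, q) (v', w'),
       second_differential (prod_scale s s') s'' (rep_dom (prod_chart c d) e f) (rep (prod_chart c d) e f)
         (snd c p, snd d q) (v, w) (v', w') +
       drep (prod_scale s s') s'' (prod_chart c d) e f (p, q) (v'', w''))"
    using tangent_chart_self[OF A(1) c(1) p(1)] tangent_chart_self[OF A(2) c(2) p(2)]
      by (simp add: drep_def)
qed

section \<open>A chart around the neutral element\<close>

lemma smooth_manifold_imp_C2_atlas:
  "topological_module s \<Longrightarrow> manifold s A \<Longrightarrow> C2_atlas s A"
  by (simp add: manifold_def C2_atlas_def smooth_on_imp_C2_on)

lemma smooth_map_imp_C2_map:
  "topological_module s \<Longrightarrow> smooth_map s A s' B f \<Longrightarrow> C2_map s A s' B f"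
  by (simp add: smooth_map_def C2_map_def smooth_on_imp_C2_on)

lemma component_Collect:
  "c \<in> A \<Longrightarrow> p \<in> fst c \<Longrightarrow> component c (p, {(d, h d) |d. d \<in> A \<and> p \<in> fst d}) = h c"
  by (simp add: component_def del: split_paired_Ex)

lemma (in group) commutator_eqI:
  assumes "g \<in> carrier G" "h \<in> carrier G" "k \<in> carrier G" "g \<otimes> h = k \<otimes> (h \<otimes> g)"
  shows "commutator G g h = k"
proof -
  have cancel: "k \<otimes> x \<otimes> inv x = k" if "x \<in> carrier G" for x
    using assms(3) that by (simp add: m_assoc)
  have "commutator G g h = g \<otimes> h \<otimes> inv (h \<otimes> g)"
    using assms(1,2) by (simp add: commutator_def inv_mult_group m_assoc)
  then show ?thesis using cancel[of "h \<otimes> g"] assms by simp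
qed

locale lie_group_chart = lie_group scale A G
  for scale :: "'k::smooth_base_ring \<Rightarrow> 'v::{topological_ab_group_add,t2_space} \<Rightarrow> 'v"
    and A :: "('g, 'v) atlas"
    and G :: "('g, 'b) monoid_scheme" (structure) +
  fixes c :: "('g, 'v) chart"
  assumes chart: "c \<in> A" and one_in_chart: "\<one> \<in> fst c"
begin

abbreviation "scale2 \<equiv> prod_scale scale scale"
abbreviation "gmult \<equiv> (\<lambda>(x, y). x \<otimes> y)"
abbreviation "cdom \<equiv> rep_dom (prod_chart c c) c gmult"
abbreviation "cmult \<equiv> rep (prod_chart c c) c gmult"
abbreviation "origin \<equiv> snd c \<one>"
abbreviation "cdiff \<equiv> differential scale2 scale cdom cmult"

text \<open>The mixed second differential of the multiplication at the neutral element. The Lie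
  bracket is its antisymmetrization.\<close>

definition "mixed v w = second_differential scale2 scale cdom cmult (origin, origin) (v, 0) (0, w)"

abbreviation "Tc \<equiv> tangent_chart scale A c"
abbreviation "TTE \<equiv> TT_element scale A c \<one>"
abbreviation "tv \<equiv> tangent_vector scale A c \<one>"
abbreviation "H \<equiv> TT_fiber scale A G"

lemma module_scale: "topological_module scale" by unfold_locales
lemma module_scale2: "topological_module scale2" by (intro topological_module_prod_scale module_scale)

lemma C2A: "C2_atlas scale A" by (rule smooth_manifold_imp_C2_atlas[OF module_scale manifold])
lemma C1A: "C1_atlas scale A" by (rule C2_atlas_imp_C1_atlas[OF C2A])
lemma C1TA: "C1_atlas scale2 (tangent_bundle scale A)" by (rule C1_atlas_tangent_bundle[OF C2A])
lemma C2_mult: "C2_map scale2 (prod_atlas A A) scale A gmult"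
  by (rule smooth_map_imp_C2_map[OF module_scale2 smooth_mult])
lemma C1_mult: "C1_map scale2 (prod_atlas A A) scale A gmult"
  by (rule C2_map_imp_C1_map[OF C2_mult])
lemma C2_cmult: "C2_on scale2 scale cdom cmult"
  using C2_mult chart by (simp add: C2_map_def prod_chart_in_prod_atlas)
lemma C1_cmult: "C1_on scale2 scale cdom cmult"
  by (rule C2_on_imp_C1_on[OF C2_cmult])

lemma in_carrier: "a \<in> A \<Longrightarrow> p \<in> fst a \<Longrightarrow> p \<in> carrier G"
  by (auto simp: carrier_eq points_def)

lemma inj_on_chart: "a \<in> A \<Longrightarrow> inj_on (snd a) (fst a)" by (rule C1_atlasD(2)[OF C1A])

lemma in_cdom: "p \<in> fst c \<Longrightarrow> q \<in> fst c \<Longrightarrow> (snd c p, snd c q) \<in> cdom \<longleftrightarrow> p \<otimes> q \<in> fst c"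
  using chart_in_rep_dom[OF inj_on_prod_chart[OF inj_on_chart inj_on_chart, OF chart chart], of
    "(p, q)" c gmult] by simp

lemma cmult_chart: "p \<in> fst c \<Longrightarrow> q \<in> fst c \<Longrightarrow> cmult (snd c p, snd c q) = snd c (p \<otimes> q)"
  using rep_chart[OF inj_on_prod_chart[OF inj_on_chart inj_on_chart, OF chart chart], of
    "(p, q)" c gmult] by simp

lemma cdom_imp: "(x, y) \<in> cdom \<Longrightarrow> x \<in> snd c ` fst c \<and> y \<in> snd c ` fst c"
  by (auto elim!: rep_domE)

text \<open>Multiplication by the neutral element on either side is defined on the whole chart
  image and is the identity there.\<close>

lemma in_cdom_origin: "(x, origin) \<in> cdom \<longleftrightarrow> x \<in> snd c ` fst c" "(origin, x) \<in> cdom \<longleftrightarrow> x \<in> snd c ` fst c"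
  using in_cdom one_in_chart in_carrier[OF chart] by (auto dest: cdom_imp)

lemma cmult_origin: "x \<in> snd c ` fst c \<Longrightarrow> cmult (x, origin) = x" "x \<in> snd c ` fst c
  \<Longrightarrow> cmult (origin, x) = x"
  using cmult_chart one_in_chart in_carrier[OF chart] by auto

lemma origin_in: "origin \<in> snd c ` fst c" "(origin, origin) \<in> cdom"
  using one_in_chart in_cdom_origin by auto

lemma cdiff_left: "x \<in> snd c ` fst c \<Longrightarrow> cdiff (x, origin) (v, 0) = v"
  by (rule differential_eq_linear[OF module_scale2 module_scale C1_cmult])
    (auto simp: in_cdom_origin cmult_origin topological_module_simps[OF module_scale])

lemma cdiff_right: "x \<in> snd c ` fst c \<Longrightarrow> cdiff (origin, x) (0, v) = v"
  by (rule differential_eq_linear[OF module_scale2 module_scale C1_cmult])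
    (auto simp: in_cdom_origin cmult_origin topological_module_simps[OF module_scale])

lemma cdiff_origin: "cdiff (origin, origin) (v, w) = v + w"
  using differential_add[OF module_scale2 module_scale C1_cmult origin_in(2), of "(v, 0)" "(0, w)"]
  by (simp add: cdiff_left cdiff_right origin_in)

text \<open>The parts with both vectors in one factor vanish because \<open>d\<mu>(x, o)(v, 0) =
  v\<close> does not depend on \<open>x\<close>. Symmetry turns the part with \<open>(0,
  w)\<close> and \<open>(v', 0)\<close> into a value of \<open>mixed\<close>.\<close>

lemma second_differential_origin:
  "second_differential scale2 scale cdom cmult (origin, origin) (v, w) (v', w') = mixed v w' + mixed v' w"
proof -
  note m = module_scale2 module_scale C2_cmult origin_in(2)
  let ?D = "second_differential scale2 scale cdom cmult (origin, origin)"
  have "?D (v, 0) (v', 0) = 0" "?D (0, w) (0, w') = 0"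
    by (rule second_differential_eq_0[OF m];
        simp add: topological_module_simps[OF module_scale] in_cdom_origin cdiff_left cdiff_right
          origin_in)+
  moreover have "?D (0, w) (v', 0) = mixed v' w"
    unfolding mixed_def by (rule second_differential_sym[OF m])
  moreover have "?D (v, w) (v', w') = ?D (v, 0) (v', 0) + ?D (v, 0) (0, w') + (?D (0, w) (v', 0) +
    ?D (0, w) (0, w'))"
    using second_differential_add(2)[OF m, of "(v, 0)" "(0, w)"]
      second_differential_add(1)[OF m, of _ "(v', 0)" "(0, w')"] by simp
  ultimately show ?thesis by (simp add: mixed_def)
qed

lemma mixed_add: "mixed (v + v') w = mixed v w + mixed v' w" "mixed v (w + w') = mixed v w + mixed v w'"
  using second_differential_add(2)[OF module_scale2 module_scale C2_cmult origin_in(2), of "(v, 0)"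
    "(v', 0)" "(0, w)"]
    second_differential_add(1)[OF module_scale2 module_scale C2_cmult origin_in(2), of "(v, 0)"
      "(0, w)" "(0, w')"]
  by (simp_all add: mixed_def)

lemma mixed_0: "mixed 0 w = 0" "mixed v 0 = 0"
  using mixed_add(1)[of 0 0 w] mixed_add(2)[of v 0 0] by simp_all

lemma mixed_minus: "mixed (- v) w = - mixed v w" "mixed v (- w) = - mixed v w"
  using mixed_add(1)[of v "- v" w] mixed_add(2)[of v w "- w"]
  by (simp_all add: mixed_0 eq_neg_iff_add_eq_0 add.commute)

section \<open>The fiber of the second tangent group\<close>

lemma Tc_in_tangent_bundle: "Tc \<in> tangent_bundle scale A"
  using chart by (simp add: tangent_bundle_def)

lemma tv_in_Tc: "tv v \<in> fst Tc"
  using in_tangent_chart[OF C1A chart chart one_in_chart] one_in_chart by simp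

text \<open>The element with coordinates \<open>(v\<^sub>1, v\<^sub>2,
  v\<^sub>1\<^sub>2)\<close> is a tangent vector of \<open>TG\<close> at the tangent vector with
  component \<open>v\<^sub>1\<close>.\<close>

lemma TTE_eq: "TTE v1 v2 v12 = tangent_vector scale2 (tangent_bundle scale A) Tc (tv v1) (v2, v12)"
  using chart_inv_tangent_chart[OF C1TA Tc_in_tangent_bundle tv_in_Tc] tangent_chart_self[OF C1A
    chart one_in_chart]
  by (simp add: TT_element_def)

lemma mult_tangent_group: "tv v \<otimes>\<^bsub>tangent_group scale A G\<^esub> tv w = tv (v + w)"
  using tangent_map_pair[OF C1A C1A C1A C1_mult chart chart chart one_in_chart one_in_chart, of v w]
    one_in_chart
  by (simp add: tangent_group_def drep_def cdiff_origin)

text \<open>The second tangent map of the multiplication, evaluated at \<open>(o, o)\<close>,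
  where the differential is the addition and the second differential is given by
  \<open>mixed\<close>.\<close>

lemma mult_TT_fiber: "TTE v1 v2 v12 \<otimes>\<^bsub>H\<^esub> TTE w1 w2 w12 =
   TTE (v1 + w1) (v2 + w2) (v12 + w12 + (mixed v1 w2 + mixed v2 w1))"
proof -
  let ?F = "\<lambda>(\<xi>, \<eta>). tangent_map scale2 scale A gmult (tangent_pair \<xi> \<eta>)"
  have F: "(\<lambda>(x, y). x \<otimes>\<^bsub>tangent_group scale A G\<^esub> y) = ?F"
    by (simp add: tangent_group_def)
  have Fv: "?F (tv v1, tv w1) = tv (v1 + w1)"
    using mult_tangent_group[of v1 w1] by (simp add: tangent_group_def)
  have C1: "C1_map (prod_scale scale2 scale2) (prod_atlas (tangent_bundle scale A) (tangent_bundle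
    scale A))
      scale2 (tangent_bundle scale A) ?F"
    by (rule C1_map_tangent_map_pair(1)[OF C1A C1A C1A C2_mult])
  have "TTE v1 v2 v12 \<otimes>\<^bsub>H\<^esub> TTE w1 w2 w12 =
      tangent_map (prod_scale scale2 scale2) scale2 (tangent_bundle scale A) ?F
        (tangent_pair (TTE v1 v2 v12) (TTE w1 w2 w12))"
    unfolding F[symmetric] by (simp add: TT_fiber_def TT_group_def tangent_group_def)
  also have "\<dots> = tangent_vector scale2 (tangent_bundle scale A) Tc (?F (tv v1, tv w1))
      (drep (prod_scale scale2 scale2) scale2 (prod_chart Tc Tc) Tc ?F (tv v1, tv w1) ((v2, v12),
        (w2, w12)))"
    unfolding TTE_eq
    by (rule tangent_map_pair[OF C1TA C1TA C1TA C1 Tc_in_tangent_bundle Tc_in_tangent_bundle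
      Tc_in_tangent_bundle tv_in_Tc tv_in_Tc])
      (use Fv tv_in_Tc[of "v1 + w1"] in simp)
  also have "drep (prod_scale scale2 scale2) scale2 (prod_chart Tc Tc) Tc ?F (tv v1, tv w1) ((v2,
    v12), (w2, w12)) =
      (v2 + w2, v12 + w12 + (mixed v1 w2 + mixed v2 w1))"
    using C1_map_tangent_map_pair(2)[OF C1A C1A C1A C2_mult chart chart chart one_in_chart one_in_chart,
        of v1 w1 v2 v12 w2 w12] one_in_chart
    by (simp add: drep_def cdiff_origin second_differential_origin add_ac)
  also have "tangent_vector scale2 (tangent_bundle scale A) Tc (?F (tv v1, tv w1)) (v2 + w2, v12 +
    w12 + (mixed v1 w2 + mixed v2 w1)) =
      TTE (v1 + w1) (v2 + w2) (v12 + w12 + (mixed v1 w2 + mixed v2 w1))"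
    unfolding Fv TTE_eq ..
  finally show ?thesis .
qed

lemma carrier_TT_fiber: "\<xi> \<in> carrier H \<longleftrightarrow> (\<exists>v1 v2 v12. \<xi> = TTE v1 v2 v12)"
proof
  assume "\<xi> \<in> carrier H"
  then have \<xi>: "\<xi> \<in> points (tangent_bundle scale2 (tangent_bundle scale A))" "fst (fst \<xi>) = \<one>"
    by (simp_all add: TT_fiber_def TT_group_def tangent_group_def)
  obtain C P V where "C \<in> tangent_bundle scale A" "P \<in> fst C" "fst \<xi> = P"
    using \<xi>(1) by (auto elim!: points_tangent_bundleE)
  then have "fst \<xi> \<in> points (tangent_bundle scale A)" by (auto simp: points_def)
  from points_tangent_bundle_chart[OF C1A chart this] one_in_chart
  have 1: "fst \<xi> = tv (component c (fst \<xi>))" using \<xi>(2) by simp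
  then have "fst \<xi> \<in> fst Tc" using tv_in_Tc by metis
  from points_tangent_bundle_chart[OF C1TA Tc_in_tangent_bundle \<xi>(1) this]
  show "\<exists>v1 v2 v12. \<xi> = TTE v1 v2 v12" unfolding TTE_eq using 1 by (metis surj_pair)
next
  assume "\<exists>v1 v2 v12. \<xi> = TTE v1 v2 v12"
  then show "\<xi> \<in> carrier H"
    using tangent_vector_in_points[OF Tc_in_tangent_bundle tv_in_Tc]
    by (auto simp: TT_fiber_def TT_group_def tangent_group_def TTE_eq)
qed

lemma one_TT_fiber: "\<one>\<^bsub>H\<^esub> = TTE 0 0 0"
proof -
  have "zero_vector A \<one> = tv 0" by (rule zero_vector_eq[OF C1A chart one_in_chart])
  moreover have "zero_vector (tangent_bundle scale A) (tv 0) = TTE 0 0 0"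
    using zero_vector_eq[OF C1TA Tc_in_tangent_bundle tv_in_Tc] by (simp add: TTE_eq zero_prod_def)
  ultimately show ?thesis by (simp add: TT_fiber_def TT_group_def tangent_group_def)
qed

text \<open>With the explicit product, associativity is biadditivity of \<open>mixed\<close>: in
  both bracketings the third coordinates add up, together with \<open>mixed x\<^sub>1 y\<^sub>2
  + mixed x\<^sub>2 y\<^sub>1\<close> for every factor \<open>x\<close> to the left of a factor
  \<open>y\<close>.\<close>

lemma group_TT_fiber: "group H"
proof (rule groupI)
  fix x assume "x \<in> carrier H"
  then obtain v1 v2 v12 where x: "x = TTE v1 v2 v12" by (auto simp: carrier_TT_fiber)
  show "\<one>\<^bsub>H\<^esub> \<otimes>\<^bsub>H\<^esub> x = x" by (simp add: x one_TT_fiber mult_TT_fiber mixed_0)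
  \<comment> \<open>the third coordinate cancels \<open>mixed (- v1) v2 + mixed (- v2) v1\<close>\<close>
  have "TTE (- v1) (- v2) (- v12 + mixed v1 v2 + mixed v2 v1) \<otimes>\<^bsub>H\<^esub> x = \<one>\<^bsub>H\<^esub>"
    by (simp add: x one_TT_fiber mult_TT_fiber mixed_minus)
  then show "\<exists>y\<in>carrier H. y \<otimes>\<^bsub>H\<^esub> x = \<one>\<^bsub>H\<^esub>" using carrier_TT_fiber by blast
qed (auto simp: carrier_TT_fiber mult_TT_fiber one_TT_fiber mixed_add add_ac, metis)

section \<open>The Lie bracket in a chart\<close>

text \<open>Right translation by \<open>g\<close> is \<open>\<mu>\<close> with the second
  argument fixed, so its differential at the origin is a partial differential of
  \<open>\<mu>\<close>.\<close>

lemma component_right_invariant_field: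
  assumes g: "g \<in> fst c"
  shows "component c (right_invariant_field scale A G (tv v) g) = cdiff (origin, snd c g) (v, 0)"
proof -
  let ?f = "\<lambda>x. x \<otimes> g"
  have g': "g \<in> carrier G" using in_carrier[OF chart g] .
  have cont: "continuous_on UNIV (\<lambda>x. (x, snd c g))" "continuous_on UNIV (\<lambda>x::'v. (x, 0::'v))"
    by (intro continuous_intros)+
  have lin: "(x + scale t w, snd c g) = (x, snd c g) + scale2 t (w, 0)" for x w t
    by (simp add: topological_module_simps[OF module_scale])
  have dom: "rep_dom a b ?f = (\<lambda>x. (x, snd c g)) -` rep_dom (prod_chart a c) b gmult" for a b
  proof (intro equalityI subsetI)
    fix x assume "x \<in> rep_dom a b ?f"
    then obtain p where "p \<in> fst a" "p \<otimes> g \<in> fst b" "x = snd a p" by (rule rep_domE)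
    then have "(p, g) \<in> fst (prod_chart a c) \<inter> gmult -` fst b" "(x, snd c g)
      = snd (prod_chart a c) (p, g)"
      using g by simp_all
    then show "x \<in> (\<lambda>x. (x, snd c g)) -` rep_dom (prod_chart a c) b gmult"
      unfolding rep_dom_def by blast
  next
    fix x assume "x \<in> (\<lambda>x. (x, snd c g)) -` rep_dom (prod_chart a c) b gmult"
    then have "(x, snd c g) \<in> rep_dom (prod_chart a c) b gmult" by simp
    then obtain p q where "p \<in> fst a" "q \<in> fst c" "p \<otimes> q \<in> fst b" "x = snd a p" "snd c g = snd c q"
      by (auto elim!: rep_domE)
    moreover from this have "q = g" using g inj_onD[OF inj_on_chart[OF chart]] by metis
    ultimately show "x \<in> rep_dom a b ?f" unfolding rep_dom_def by blast
  qed
  have rep: "rep a b ?f x = rep (prod_chart a c) b gmult (x, snd c g)"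
    if x: "x \<in> rep_dom a b ?f" and a: "a \<in> A" for a b x
  proof -
    obtain p where p: "p \<in> fst a" "x = snd a p" using x by (rule rep_domE)
    show ?thesis
      using p g rep_chart[OF inj_on_prod_chart[OF inj_on_chart inj_on_chart, OF a chart], of
        "(p, g)" b gmult]
        rep_chart[OF inj_on_chart[OF a] p(1)] by simp
  qed
  have C1: "C1_on scale2 scale (rep_dom (prod_chart a c) b gmult) (rep (prod_chart a c) b gmult)"
    if "a \<in> A" "b \<in> A" for a b
    by (rule C1_mapD[OF C1_mult]) (use that chart in \<open>auto simp: prod_chart_in_prod_atlas\<close>)
  note aff = C1_on_affine[OF module_scale module_scale2 module_scale C1 cont lin]
  have C1f: "C1_on scale scale (rep_dom a b ?f) (rep a b ?f)" if "a \<in> A" "b \<in> A" for a b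
    unfolding dom by (rule C1_on_cong[OF aff(1)[OF that]]) (simp add: rep[OF _ that(1)] dom)
  have f: "C1_map scale A scale A ?f"
    unfolding C1_map_def using C1f m_closed[OF _ g'] by (auto simp: carrier_eq)
  have fone: "\<one> \<otimes> g \<in> fst c" using g g' by simp
  have mem: "(origin, snd c g) \<in> cdom" using in_cdom[OF one_in_chart g] fone by simp
  have "component c (right_invariant_field scale A G (tv v) g) = drep scale scale c c ?f \<one> v"
    unfolding right_invariant_field_def
    using tangent_map_tangent_vector[OF C1A C1A f chart chart one_in_chart fone]
      component_tangent_vector_self[OF C1A chart fone] by simp
  also have "\<dots> = differential scale scale ((\<lambda>x. (x, snd c g)) -` cdom) (\<lambda>x. cmult (x, snd c g)) origin v"
    unfolding drep_def
    by (rule differential_local[OF module_scale module_scale C1f[OF chart chart] aff(1)[OF chart chart]])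
      (use mem in \<open>simp_all add: dom rep[OF _ chart]\<close>)
  also have "\<dots> = cdiff (origin, snd c g) (v, 0)"
    by (rule aff(2)[OF chart chart mem])
  finally show ?thesis .
qed

text \<open>Since \<open>\<mu>(o, x)\<close> is defined for every \<open>x\<close> in the chart
  image, the formula for the principal part holds on the whole image. Differentiating it at the
  origin gives a mixed second differential.\<close>

lemma differential_right_invariant_field:
  "differential scale scale (snd c ` fst c) (principal_part c (right_invariant_field scale A G (tv
    v))) origin w = mixed v w"
proof -
  let ?L = "\<lambda>y. ((origin, y), (v, 0::'v))" and ?L' = "\<lambda>u::'v. ((0::'v, u), (0::'v, 0::'v))"
  have cont: "continuous_on UNIV ?L" "continuous_on UNIV ?L'" by (intro continuous_intros)+
  have lin: "?L (y + scale t u) = ?L y + prod_scale scale2 scale2 t (?L' u)" for y t u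
    by (simp add: topological_module_simps[OF module_scale])
  note aff = C1_on_affine[OF module_scale topological_module_prod_scale[OF module_scale2
    module_scale2] module_scale
      C2_on_differential[OF module_scale2 module_scale C2_cmult] cont lin]
  have dom: "?L -` (cdom \<times> UNIV) = snd c ` fst c" by (auto simp: in_cdom_origin)
  have pp: "cdiff (origin, x) (v, 0) = principal_part c (right_invariant_field scale A G (tv v)) x"
    if "x \<in> snd c ` fst c" for x
    using chart_chart_inv[OF that] component_right_invariant_field by (simp add: principal_part_def)
  have 1: "C1_on scale scale (snd c ` fst c) (\<lambda>y. cdiff (origin, y) (v, 0))"
    using aff(1) by (simp add: dom)
  have "differential scale scale (snd c ` fst c) (principal_part c (right_invariant_field scale A G
    (tv v))) origin w =
      differential scale scale (snd c ` fst c) (\<lambda>y. cdiff (origin, y) (v, 0)) origin w"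
    by (rule differential_local[OF module_scale module_scale C1_on_cong[OF 1 pp] 1]) (auto simp:
      origin_in pp)
  also have "\<dots> = mixed v w"
    using aff(2)[of origin w] origin_in by (simp add: dom mixed_def second_differential_def zero_prod_def)
  finally show ?thesis .
qed

lemma component_lie_bracket:
  "component c (lie_bracket scale A G (tv v) (tv w)) = mixed v w - mixed w v"
proof -
  have "component c (right_invariant_field scale A G (tv v) \<one>) = v" for v
    by (simp add: component_right_invariant_field one_in_chart cdiff_left origin_in)
  then show ?thesis
    unfolding lie_bracket_def field_bracket_def component_Collect[OF chart one_in_chart]
    by (simp add: differential_right_invariant_field)
qed

section \<open>Commutators of axis elements\<close>

lemma tangent_space_chart:
  assumes "v \<in> tangent_space scale A \<one>"
  obtains x where "v = tv x" "component c v = x"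
  using points_tangent_bundle_chart[OF C1A chart, of v] assms one_in_chart
    by (auto simp: tangent_space_def)

lemma eps_tv: "eps1 scale A c (tv x) = TTE x 0 0" "eps2 scale A c (tv x) = TTE 0 x 0"
  "eps12 scale A c (tv x) = TTE 0 0 x"
  by (simp_all add: eps1_def eps2_def eps12_def component_tangent_vector_self[OF C1A chart one_in_chart])

lemma commutator_eps1_eps2:
  "commutator H (eps1 scale A c (tv x)) (eps2 scale A c (tv y))
    = eps12 scale A c (lie_bracket scale A G (tv x) (tv y))"
proof -
  have "fst (lie_bracket scale A G (tv x) (tv y)) = \<one>" by (simp add: lie_bracket_def field_bracket_def)
  then have "eps12 scale A c (lie_bracket scale A G (tv x) (tv y)) = TTE 0 0 (mixed x y - mixed y x)"
    by (simp add: eps12_def component_lie_bracket)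
  then show ?thesis
    unfolding eps_tv by (intro group.commutator_eqI[OF group_TT_fiber]) (auto simp: carrier_TT_fiber
      mult_TT_fiber mixed_0)
qed

lemma eps12_central: "h \<in> carrier H \<Longrightarrow> eps12 scale A c (tv x) \<otimes>\<^bsub>H\<^esub> h = h \<otimes>\<^bsub>H\<^esub> eps12 scale A c (tv x)"
  by (auto simp: carrier_TT_fiber eps_tv mult_TT_fiber mixed_0 add_ac)

lemma commutator_eps12:
  assumes h: "h \<in> carrier H"
  shows "commutator H (eps12 scale A c (tv x)) h = \<one>\<^bsub>H\<^esub>"
proof -
  interpret H: group H by (rule group_TT_fiber)
  have x: "eps12 scale A c (tv x) \<in> carrier H" by (auto simp: carrier_TT_fiber eps_tv)
  show ?thesis
    by (rule H.commutator_eqI) (use h x eps12_central[OF h] in auto)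
qed

end

theorem theorem23p2:
  fixes scale :: "'k::smooth_base_ring \<Rightarrow> 'v::{topological_ab_group_add,t2_space} \<Rightarrow> 'v"
    and A :: "('g, 'v) atlas"
    and G :: "('g, 'b) monoid_scheme"
    and c :: "('g, 'v) chart"
  assumes "lie_group scale A G"
    and "c \<in> A" and "\<one>\<^bsub>G\<^esub> \<in> fst c"
  shows
    "(\<forall>v \<in> tangent_space scale A \<one>\<^bsub>G\<^esub>. \<forall>w \<in> tangent_space scale A \<one>\<^bsub>G\<^esub>.
        commutator (TT_fiber scale A G) (eps1 scale A c v) (eps2 scale A c w)
          = eps12 scale A c (lie_bracket scale A G v w)) \<and>
     (\<forall>u \<in> tangent_space scale A \<one>\<^bsub>G\<^esub>. \<forall>h \<in> carrier (TT_fiber scale A G).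
        eps12 scale A c u \<otimes>\<^bsub>TT_fiber scale A G\<^esub> h = h \<otimes>\<^bsub>TT_fiber scale A G\<^esub> eps12 scale A c u) \<and>
     (\<forall>u \<in> tangent_space scale A \<one>\<^bsub>G\<^esub>. \<forall>v \<in> tangent_space scale A \<one>\<^bsub>G\<^esub>.
        commutator (TT_fiber scale A G) (eps12 scale A c u) (eps1 scale A c v) = \<one>\<^bsub>TT_fiber scale A G\<^esub> \<and>
        commutator (TT_fiber scale A G) (eps12 scale A c u) (eps2 scale A c v) = \<one>\<^bsub>TT_fiber scale A G\<^esub>)"
proof -
  interpret lie_group_chart scale A G c
    using assms by (simp add: lie_group_chart_def lie_group_chart_axioms_def)
  have eps: "eps1 scale A c (tv x) \<in> carrier H" "eps2 scale A c (tv x) \<in> carrier H" for x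
    by (auto simp: carrier_TT_fiber eps_tv)
  have chart: "\<exists>x. v = tv x" if "v \<in> tangent_space scale A \<one>\<^bsub>G\<^esub>" for v
    using that by (blast elim: tangent_space_chart)
  show ?thesis
  proof (intro conjI ballI)
    fix v w assume "v \<in> tangent_space scale A \<one>\<^bsub>G\<^esub>" "w \<in> tangent_space scale A \<one>\<^bsub>G\<^esub>"
    then obtain x y where "v = tv x" "w = tv y" using chart by blast
    then show "commutator H (eps1 scale A c v) (eps2 scale A c w)
      = eps12 scale A c (lie_bracket scale A G v w)"
      and "commutator H (eps12 scale A c v) (eps1 scale A c w) = \<one>\<^bsub>H\<^esub>"
      and "commutator H (eps12 scale A c v) (eps2 scale A c w) = \<one>\<^bsub>H\<^esub>"
      by (simp_all add: commutator_eps1_eps2 commutator_eps12 eps)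
  next
    fix u h assume "u \<in> tangent_space scale A \<one>\<^bsub>G\<^esub>" "h \<in> carrier H"
    then show "eps12 scale A c u \<otimes>\<^bsub>H\<^esub> h = h \<otimes>\<^bsub>H\<^esub> eps12 scale A c u"
      using chart eps12_central by blast
  qed
qed

end
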